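(* Let $I=[a,b]\subset\mathbb{R}$ be a closed interval, let $f:I\to I$ be a continuous map with zero topological entropy, and let $K\subseteq I$ be a minimal subset of $f$. Then every ergodic $f|K$-invariant regular Borel probability measure $\mu$ on $K$ has discrete spectrum, that is, there exists an orthonormal basis of $L^2(\mu)$ consisting of eigenfunctions.
   Context: Here $\mathbb{N}=\{1,2,3,\dots\}$ and $f^n$ denotes the $n$-th iterate of $f$. Minimal subset: a closed subset $K\subset I$ is minimal (with respect to $f$) if $f(K)\subset K$ and $\overline{\{f^nx : n\in\mathbb{N}\}}=K$ for every $x\in K$. A regular Borel probability measure $\mu$ on $K$ is invariant if $\mu((f|K)^{-1}(A))=\mu(A)$ for all Borel sets $A\subset K$. $L^2(\mu)$ is the space of complex-valued $L^2$ functions. A complex number $\lambda$ is an eigenvalue, with eigenfunction $\phi\in L^2(\mu)$ (nonzero), if $\phi(fx)=\lambda\phi(x)$ for $\mu$-a.e. $x\in K$. *)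

theory Defs
  imports "HOL-Probability.Probability"
begin

definition dyn_separated ::
  "('a::metric_space \<Rightarrow> 'a) \<Rightarrow> nat \<Rightarrow> real \<Rightarrow> 'a set \<Rightarrow> bool" where
  "dyn_separated f n e E \<longleftrightarrow>
     (\<forall>x\<in>E. \<forall>y\<in>E. x \<noteq> y \<longrightarrow> (\<exists>k<n. dist ((f ^^ k) x) ((f ^^ k) y) > e))"

text \<open>Topological entropy of \<open>f : X \<rightarrow> X\<close> on a nonempty compact metric space \<open>X\<close>, in the
  Bowen--Dinaburg form: the limit, as \<open>e\<close> decreases to \<open>0\<close>, of the exponential growth rate in
  \<open>n\<close> of the maximal cardinality of an \<open>(n,e)\<close>-separated subset of \<open>X\<close>. The growth rate is
  antitone in \<open>e\<close>, so the limit is a supremum; the supremum over \<open>E\<close> is taken after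
  the (monotone) logarithm and the division by \<open>n\<close>, so that it lives in the extended reals.\<close>

definition topological_entropy :: "'a::metric_space set \<Rightarrow> ('a \<Rightarrow> 'a) \<Rightarrow> ereal" where
  "topological_entropy X f =
     (SUP e\<in>{0<..}. limsup (\<lambda>n.
        SUP E\<in>{E. E \<subseteq> X \<and> finite E \<and> E \<noteq> {} \<and> dyn_separated f n e E}.
          ereal (ln (real (card E)) / real n)))"

definition minimal_subset :: "'a::topological_space set \<Rightarrow> ('a \<Rightarrow> 'a) \<Rightarrow> 'a set \<Rightarrow> bool" where
  "minimal_subset X f K \<longleftrightarrow>
     K \<subseteq> X \<and> closed K \<and> f ` K \<subseteq> K \<and>
     (\<forall>x\<in>K. closure {(f ^^ n) x | n. n \<ge> 1} = K)"

definition regular_borel_prob :: "'a::topological_space set \<Rightarrow> 'a measure \<Rightarrow> bool" where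
  "regular_borel_prob K M \<longleftrightarrow>
     prob_space M \<and> sets M = sets (restrict_space borel K) \<and>
     (\<forall>A\<in>sets M.
        emeasure M A = (SUP C\<in>{C. compact C \<and> C \<subseteq> A}. emeasure M C) \<and>
        emeasure M A = (INF U\<in>{U. openin (top_of_set K) U \<and> A \<subseteq> U}. emeasure M U))"

definition invariant_measure :: "'a measure \<Rightarrow> ('a \<Rightarrow> 'a) \<Rightarrow> bool" where
  "invariant_measure M f \<longleftrightarrow>
     f \<in> measurable M M \<and>
     (\<forall>A\<in>sets M. measure M (f -` A \<inter> space M) = measure M A)"

definition ergodic_measure :: "'a measure \<Rightarrow> ('a \<Rightarrow> 'a) \<Rightarrow> bool" where
  "ergodic_measure M f \<longleftrightarrow>
     invariant_measure M f \<and>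
     (\<forall>A\<in>sets M. f -` A \<inter> space M = A \<longrightarrow> measure M A = 0 \<or> measure M A = 1)"

text \<open>Elements of the Hilbert space \<open>L\<^sup>2(M)\<close> are given by representatives; two representatives
  denote the same element iff they agree almost everywhere.\<close>

definition L2 :: "'a measure \<Rightarrow> ('a \<Rightarrow> complex) set" where
  "L2 M = {g \<in> borel_measurable M. integrable M (\<lambda>x. (cmod (g x))\<^sup>2)}"

definition L2_inner :: "'a measure \<Rightarrow> ('a \<Rightarrow> complex) \<Rightarrow> ('a \<Rightarrow> complex) \<Rightarrow> complex" where
  "L2_inner M g h = (LINT x|M. g x * cnj (h x))"

definition L2_norm :: "'a measure \<Rightarrow> ('a \<Rightarrow> complex) \<Rightarrow> real" where
  "L2_norm M g = sqrt (LINT x|M. (cmod (g x))\<^sup>2)"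

text \<open>Orthonormality forces distinct members of \<open>B\<close> to represent distinct elements of \<open>L\<^sup>2(M)\<close>;
  the last conjunct says that the linear span of \<open>B\<close> is dense.\<close>

definition L2_orthonormal_basis :: "'a measure \<Rightarrow> ('a \<Rightarrow> complex) set \<Rightarrow> bool" where
  "L2_orthonormal_basis M B \<longleftrightarrow>
     B \<subseteq> L2 M \<and>
     (\<forall>g\<in>B. \<forall>h\<in>B. L2_inner M g h = (if g = h then 1 else 0)) \<and>
     (\<forall>g\<in>L2 M. \<forall>e>0. \<exists>F c. finite F \<and> F \<subseteq> B \<and>
        L2_norm M (\<lambda>x. g x - (\<Sum>h\<in>F. c h * h x)) < e)"

definition L2_eigenfunction ::
  "'a measure \<Rightarrow> ('a \<Rightarrow> 'a) \<Rightarrow> complex \<Rightarrow> ('a \<Rightarrow> complex) \<Rightarrow> bool" where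
  "L2_eigenfunction M f c g \<longleftrightarrow>
     g \<in> L2 M \<and> \<not> (AE x in M. g x = 0) \<and> (AE x in M. g (f x) = c * g x)"

definition discrete_spectrum :: "'a measure \<Rightarrow> ('a \<Rightarrow> 'a) \<Rightarrow> bool" where
  "discrete_spectrum M f \<longleftrightarrow>
     (\<exists>B. L2_orthonormal_basis M B \<and> (\<forall>g\<in>B. \<exists>c. L2_eigenfunction M f c g))"

end

theory Submission
  imports Defs
begin

text \<open>Zero entropy excludes horseshoes: two disjoint compact sets each mapped by an iterate over
  their union produce exponentially many separated orbit segments. Without horseshoes, a minimal
  set with at least two points splits at some point \<open>p\<close> into a left and a right half that the map
  swaps. Both halves are minimal for the second iterate, which again has no horseshoe, so the
  splitting can be repeated: \<open>K\<close> is partitioned into \<open>2 ^ n\<close> cyclically permuted order-convex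
  pieces, for all \<open>n\<close> or until the pieces are single points. Every invariant probability gives the
  pieces equal mass. The functions \<open>\<lambda>x. \<zeta> ^ i\<close> (for \<open>x\<close> in the \<open>i\<close>-th piece) with \<open>\<zeta>\<close> a
  \<open>2 ^ n\<close>-th root of unity are orthonormal eigenfunctions; they span the indicators of the pieces,
  and these approximate the indicators of all initial segments of \<open>K\<close>.\<close>

section \<open>Horseshoes\<close>

definition horseshoe :: "('a::topological_space \<Rightarrow> 'a) \<Rightarrow> 'a set \<Rightarrow> nat \<Rightarrow> bool" where
  "horseshoe f X n \<longleftrightarrow> n \<ge> 1 \<and> (\<exists>A B. compact A \<and> compact B \<and> A \<subseteq> X \<and> B \<subseteq> X \<and> A \<noteq> {} \<and> A \<inter> B = {} \<and>
     A \<union> B \<subseteq> (f ^^ n) ` A \<and> A \<union> B \<subseteq> (f ^^ n) ` B)"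

text \<open>Pulling a separated set back under \<open>f ^^ n\<close>, once into \<open>A\<close> and
  once into \<open>B\<close>, doubles it. Preimages in different sets are apart at time 0; preimages
  in the same set have distinct images, which separate \<open>n\<close> steps later.\<close>

lemma covering_separated_sets:
  fixes f :: "'a::metric_space \<Rightarrow> 'a"
  assumes n: "n \<ge> 1" and ne: "A \<noteq> {}"
    and covA: "A \<union> B \<subseteq> (f ^^ n) ` A" and covB: "A \<union> B \<subseteq> (f ^^ n) ` B"
    and sep: "\<And>x y. x \<in> A \<Longrightarrow> y \<in> B \<Longrightarrow> dist x y > e" and e: "e > 0"
  shows "\<exists>E. E \<subseteq> A \<union> B \<and> finite E \<and> card E = 2 ^ m \<and> dyn_separated f (n * m) e E"
proof (induction m)
  case 0
  obtain x where "x \<in> A" using ne by blast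
  then show ?case by (intro exI[of _ "{x}"]) (auto simp: dyn_separated_def)
next
  case (Suc m)
  then obtain E where E: "E \<subseteq> A \<union> B" "finite E" "card E = 2 ^ m" "dyn_separated f (n * m) e E" by blast
  obtain p where p: "\<And>x. x \<in> E \<Longrightarrow> p x \<in> A \<and> (f ^^ n) (p x) = x"
    using covA E(1) by (metis image_iff subset_iff)
  obtain q where q: "\<And>x. x \<in> E \<Longrightarrow> q x \<in> B \<and> (f ^^ n) (q x) = x"
    using covB E(1) by (metis image_iff subset_iff)
  have disj: "A \<inter> B = {}" using sep e by (metis disjoint_iff dist_self order_less_asym)
  have injp: "inj_on p E" and injq: "inj_on q E" using p q by (metis inj_onI)+
  have "card (p ` E \<union> q ` E) = card (p ` E) + card (q ` E)"
    using E(2) p q disj by (intro card_Un_disjoint) (fastforce simp: disjoint_iff)+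
  then have card: "card (p ` E \<union> q ` E) = 2 ^ Suc m"
    using injp injq E(3) by (simp add: card_image)
  have later: "\<exists>k<n * Suc m. dist ((f ^^ k) u) ((f ^^ k) v) > e"
    if uv: "(f ^^ n) u \<in> E" "(f ^^ n) v \<in> E" "(f ^^ n) u \<noteq> (f ^^ n) v" for u v
  proof -
    obtain k where "k < n * m" "dist ((f ^^ k) ((f ^^ n) u)) ((f ^^ k) ((f ^^ n) v)) > e"
      using E(4) uv unfolding dyn_separated_def by blast
    then show ?thesis
      by (intro exI[of _ "k + n"]) (auto simp: funpow_add)
  qed
  have now: "\<exists>k<n * Suc m. dist ((f ^^ k) u) ((f ^^ k) v) > e"
    if "u \<in> A \<and> v \<in> B \<or> v \<in> A \<and> u \<in> B" for u v
    using that sep[of u v] sep[of v u] n by (intro exI[of _ 0]) (auto simp: dist_commute)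
  have "dyn_separated f (n * Suc m) e (p ` E \<union> q ` E)"
    unfolding dyn_separated_def
  proof (intro ballI impI)
    fix u v assume uv: "u \<in> p ` E \<union> q ` E" "v \<in> p ` E \<union> q ` E" "u \<noteq> v"
    show "\<exists>k<n * Suc m. dist ((f ^^ k) u) ((f ^^ k) v) > e"
    proof (cases "u \<in> A \<and> v \<in> B \<or> v \<in> A \<and> u \<in> B")
      case True
      then show ?thesis by (rule now)
    next
      case False
      show ?thesis using False p q uv by (intro later) auto
    qed
  qed
  moreover have "p ` E \<union> q ` E \<subseteq> A \<union> B" using p q by blast
  ultimately show ?case using E(2) card by blast
qed

text \<open>Along the times \<open>n * m\<close> there are separated sets with \<open>2 ^ m\<close>
  points, which bounds the growth rate below by \<open>ln 2 / n\<close>; the limsup over all times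
  dominates the one over these times.\<close>

lemma horseshoe_entropy_pos:
  fixes f :: "'a::heine_borel \<Rightarrow> 'a"
  assumes "horseshoe f X n"
  shows "topological_entropy X f > 0"
proof -
  obtain A B where n: "n \<ge> 1" and AB: "compact A" "compact B" "A \<subseteq> X" "B \<subseteq> X" "A \<noteq> {}" "A \<inter> B = {}"
     "A \<union> B \<subseteq> (f ^^ n) ` A" "A \<union> B \<subseteq> (f ^^ n) ` B"
    using assms unfolding horseshoe_def by blast
  obtain e0 where e0: "e0 > 0" "\<And>x y. x \<in> A \<Longrightarrow> y \<in> B \<Longrightarrow> dist x y \<ge> e0"
    using separate_compact_closed[OF AB(1) compact_imp_closed[OF AB(2)] AB(6)] by blast
  \<comment> \<open>Halving turns the weak bound on the distance into the strict inequality in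
    \<open>dyn_separated\<close>.\<close>
  define e where "e = e0 / 2"
  have e: "e > 0" "\<And>x y. x \<in> A \<Longrightarrow> y \<in> B \<Longrightarrow> dist x y > e"
    using e0 unfolding e_def by force+
  define S where "S k = (SUP E\<in>{E. E \<subseteq> X \<and> finite E \<and> E \<noteq> {} \<and> dyn_separated f k e E}.
          ereal (ln (real (card E)) / real k))" for k
  have "S (n * m) \<ge> ereal (ln 2 / real n)" if "m \<ge> 1" for m
  proof -
    obtain E where E: "E \<subseteq> A \<union> B" "finite E" "card E = 2 ^ m" "dyn_separated f (n * m) e E"
      using covering_separated_sets[OF n AB(5,7,8) e(2,1)] by blast
    have "ln 2 / real n = ln (real (card E)) / real (n * m)"
      using that n by (simp add: E(3) ln_realpow)
    moreover have "E \<subseteq> X" "E \<noteq> {}" using E AB by auto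
    ultimately show ?thesis unfolding S_def using E by (intro SUP_upper2[of E]) auto
  qed
  then have "ereal (ln 2 / real n) \<le> limsup (S \<circ> (\<lambda>m. n * m))"
    by (intro le_Limsup) (auto simp: eventually_sequentially)
  also have "\<dots> \<le> limsup S"
    using n by (intro limsup_subseq_mono) (auto simp: strict_mono_def)
  also have "\<dots> \<le> topological_entropy X f"
    unfolding topological_entropy_def S_def using e by (intro SUP_upper) auto
  finally have "ereal (ln 2 / real n) \<le> topological_entropy X f" .
  moreover have "0 < ereal (ln 2 / real n)" using n by simp
  ultimately show ?thesis by (rule order_less_le_trans[rotated])
qed

lemma horseshoe_funpow:
  assumes "horseshoe (f ^^ k) X n" "k \<ge> 1"
  shows "horseshoe f X (k * n)"
  using assms unfolding horseshoe_def by (simp add: funpow_mult)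

lemma image_funpow_cover:
  assumes "A \<subseteq> h ` A"
  shows "h ` A \<subseteq> (h ^^ Suc j) ` A"
proof (induction j)
  case (Suc j)
  have "h ` A \<subseteq> h ` h ` A" using assms by blast
  also have "\<dots> \<subseteq> h ` ((h ^^ Suc j) ` A)" using Suc by blast
  finally show ?case by (simp add: image_comp)
qed simp

text \<open>Admits different covering times for the two sets. Each set covers itself, so its
  iterated images only grow, and \<open>n * m\<close> serves both.\<close>

lemma horseshoeI:
  assumes "n \<ge> 1" "m \<ge> 1" "compact A" "compact B" "A \<subseteq> X" "B \<subseteq> X" "A \<noteq> {}" "A \<inter> B = {}"
    "A \<union> B \<subseteq> (f ^^ n) ` A" "A \<union> B \<subseteq> (f ^^ m) ` B"
  shows "horseshoe f X (n * m)"
proof -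
  obtain n' m' where nm: "n = Suc n'" "m = Suc m'" using assms(1,2) by (metis Suc_le_D One_nat_def)
  have "A \<union> B \<subseteq> ((f ^^ n) ^^ Suc m') ` A"
    using image_funpow_cover[of A "f ^^ n" m'] assms(9) by blast
  moreover have "A \<union> B \<subseteq> ((f ^^ m) ^^ Suc n') ` B"
    using image_funpow_cover[of B "f ^^ m" n'] assms(10) by blast
  ultimately have "A \<union> B \<subseteq> (f ^^ (n * m)) ` A" "A \<union> B \<subseteq> (f ^^ (n * m)) ` B"
    unfolding funpow_mult nm by (simp_all only: mult.commute)
  then show ?thesis unfolding horseshoe_def using assms by (metis mult_le_mono nat_mult_1)
qed

section \<open>Minimal sets of interval maps without horseshoes\<close>

lemma funpow_invariant:
  assumes "f ` X \<subseteq> X" "x \<in> X"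
  shows "(f ^^ n) x \<in> X"
  using assms by (induction n) auto

lemma continuous_on_funpow_invariant:
  assumes "continuous_on X f" "f ` X \<subseteq> X"
  shows "continuous_on X (f ^^ n)"
proof (induction n)
  case (Suc n)
  have "continuous_on ((f ^^ n) ` X) f"
    using assms funpow_invariant[OF assms(2)] by (metis continuous_on_subset image_subsetI)
  then show ?case using Suc by (simp add: continuous_on_compose2[OF _ _ order_refl])
qed (simp add: id_def)

lemma minimal_subset_funpow_in:
  assumes "minimal_subset X f K" "x \<in> K"
  shows "(f ^^ n) x \<in> K"
  using assms unfolding minimal_subset_def by (intro funpow_invariant) auto

lemma minimal_subset_visits:
  assumes "minimal_subset X f K" "x \<in> K" "open U" "y \<in> K" "y \<in> U"
  obtains n where "n \<ge> 1" "(f ^^ n) x \<in> U"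
proof -
  have "y \<in> closure {(f ^^ n) x | n. n \<ge> 1}" using assms unfolding minimal_subset_def by blast
  then have "{(f ^^ n) x | n. n \<ge> 1} \<inter> U \<noteq> {}"
    using assms(3,5) open_Int_closure_eq_empty[of U] by blast
  then show ?thesis using that by blast
qed

text \<open>The orbit of a fixed point is a single closed point, too small to be dense in a set with
  two points.\<close>

lemma minimal_subset_no_fixpoint:
  fixes f :: "'a::t1_space \<Rightarrow> 'a"
  assumes "minimal_subset X f K" "x \<in> K" "y \<in> K" "x \<noteq> y"
  shows "f x \<noteq> x"
proof
  assume fx: "f x = x"
  have "(f ^^ n) x = x" for n by (induction n) (auto simp: fx)
  then have "closure {(f ^^ n) x | n. n \<ge> 1} \<subseteq> {x}"
    by (intro closure_minimal) auto
  then show False using assms unfolding minimal_subset_def by blast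
qed

text \<open>The intermediate value theorem as a covering relation. Unordered segments let one
  argument treat both sides of a point.\<close>

lemma closed_segment_subset_image:
  fixes h :: "real \<Rightarrow> real"
  assumes "continuous_on X h" "closed_segment u v \<subseteq> X" "s \<in> closed_segment u v" "t \<in> closed_segment u v"
  shows "closed_segment (h s) (h t) \<subseteq> h ` closed_segment u v"
proof -
  have "connected (h ` closed_segment u v)"
    using assms by (intro connected_continuous_image) (auto intro: continuous_on_subset)
  then have "convex (h ` closed_segment u v)" by (metis is_interval_connected_1 is_interval_convex)
  then show ?thesis using assms by (intro closed_segment_subset) auto
qed

section \<open>Motion of a minimal set about a fixed point; applied later with \<open>f ^^ k\<close>
  as \<open>g\<close> and a piece as \<open>C\<close>\<close>

context
  fixes X :: "real set" and g :: "real \<Rightarrow> real" and C :: "real set"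
  assumes X: "convex X" "compact X" and cont: "continuous_on X g" and inv: "g ` X \<subseteq> X"
    and min: "minimal_subset X g C"
    and nohs: "\<And>n. \<not> horseshoe g X n"
begin

lemma minimal_set_subset: "C \<subseteq> X" using min by (simp add: minimal_subset_def)

lemma minimal_set_compact: "compact C"
  using compact_Int_closed[OF X(2), of C] min minimal_set_subset by (simp add: minimal_subset_def Int_absorb1)

lemma iterate_continuous: "continuous_on X (g ^^ n)" by (rule continuous_on_funpow_invariant[OF cont inv])

text \<open>Otherwise a fixed point \<open>q\<close> lies between \<open>d\<close> and
  \<open>u\<close>. The intervals \<open>[d, q]\<close> and \<open>[q, u]\<close> cover themselves,
  and by minimality the orbits of \<open>d\<close> and \<open>u\<close> cross to the far side, so
  that each interval also covers the other: a horseshoe.\<close>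

lemma rising_below_falling:
  assumes "d \<in> C" "u \<in> C" "g d < d" "g u > u"
  shows "u < d"
proof (rule ccontr)
  assume "\<not> u < d"
  then have du: "d < u" using assms by (metis less_asym linorder_neqE)
  have gC: "g c \<in> C" if "c \<in> C" for c using min that by (auto simp: minimal_subset_def)
  have segX: "closed_segment d u \<subseteq> X" using X(1) assms minimal_set_subset by (intro closed_segment_subset) auto
  then have sub: "{d..u} \<subseteq> X" using du by (simp add: closed_segment_eq_real_ivl)
  have "\<exists>q. d \<le> q \<and> q \<le> u \<and> g q - q = 0"
    using assms du sub by (intro IVT' continuous_intros continuous_on_subset[OF cont]) auto
  then obtain q where q: "d < q" "q < u" "g q = q"
    using assms by (metis eq_iff_diff_eq_0 less_irrefl order_le_less)
  have gq: "(g ^^ n) q = q" for n by (induction n) (auto simp: q)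
  \<comment> \<open>The open set \<open>{..<d}\<close> meets \<open>C\<close> in \<open>g d\<close>,
    so the dense orbit of \<open>u\<close> enters it; symmetrically for \<open>d\<close> and
    \<open>{u<..}\<close>.\<close>
  obtain n where n: "(g ^^ n) u < d"
    using minimal_subset_visits[OF min \<open>u \<in> C\<close>, of "{..<d}" "g d"] assms gC by auto
  obtain l where l: "(g ^^ l) d > u"
    using minimal_subset_visits[OF min \<open>d \<in> C\<close>, of "{u<..}" "g u"] assms gC by auto
  define A where "A = {d..q}"
  define B where "B = {q..u}"
  have AX: "A \<subseteq> X" and BX: "B \<subseteq> X" using sub q by (auto simp: A_def B_def)
  have cov: "closed_segment ((g ^^ k) s) ((g ^^ k) t) \<subseteq> (g ^^ k) ` {v..w}"
    if "s \<in> {v..w}" "t \<in> {v..w}" "{v..w} \<subseteq> X" for s t v w k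
    using closed_segment_subset_image[OF iterate_continuous, of v w s t k] that
    by (auto simp: closed_segment_eq_real_ivl split: if_splits)
  have AA1: "A \<subseteq> g ` A"
    using cov[of d d q q 1] assms AX q by (auto simp: A_def closed_segment_eq_real_ivl)
  have BB1: "B \<subseteq> g ` B"
    using cov[of u q u q 1] assms BX q by (auto simp: B_def closed_segment_eq_real_ivl)
  have iter: "Y \<subseteq> (g ^^ j) ` Y" if "Y \<subseteq> g ` Y" for Y j
    using image_funpow_cover[OF that] that by (cases j) fastforce+
  have AB: "B \<subseteq> (g ^^ l) ` A"
    using cov[of d d q q l] l AX q gq by (auto simp: A_def B_def closed_segment_eq_real_ivl)
  have BA: "A \<subseteq> (g ^^ n) ` B"
    using cov[of u q u q n] n BX q gq by (auto simp: A_def B_def closed_segment_eq_real_ivl)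
  \<comment> \<open>Self-coverings serve as waiting steps that bring both crossing times to
    \<open>n + l\<close>.\<close>
  have "B \<subseteq> (g ^^ n) ` ((g ^^ l) ` A)" using iter[OF BB1, of n] AB by blast
  then have 1: "B \<subseteq> (g ^^ (n + l)) ` A" by (simp add: funpow_add image_comp)
  have "A \<subseteq> (g ^^ l) ` ((g ^^ n) ` B)" using iter[OF AA1, of l] BA by blast
  then have 2: "A \<subseteq> (g ^^ (n + l)) ` B" by (simp add: funpow_add image_comp add.commute[of n])
  define N where "N = n + l"
  have covB: "A \<union> B \<subseteq> (g ^^ N) ` B" and covA: "A \<union> B \<subseteq> (g ^^ N) ` A"
    using 1 2 iter[OF AA1] iter[OF BB1] unfolding N_def by blast+
  have "d \<in> A \<union> B" "u \<in> A \<union> B" using q by (auto simp: A_def B_def)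
  then obtain s t where s: "s \<in> A" "(g ^^ N) s = d" and t: "t \<in> A" "(g ^^ N) t = u" using covA by (metis imageE subsetD)
  have st: "s < q" "t < q" using s t gq[of N] q by (auto simp: A_def order_le_less)
  \<comment> \<open>\<open>A\<close> and \<open>B\<close> share the fixed point \<open>q\<close>, which is not mapped to an endpoint of
    \<open>A \<union> B\<close>; so \<open>A\<close> can be shortened.\<close>
  define A' where "A' = {d..max s t}"
  have A': "A' \<subseteq> A" "A' \<inter> B = {}" "A' \<noteq> {}" using st s by (auto simp: A'_def A_def B_def)
  have "A \<union> B \<subseteq> (g ^^ N) ` A'"
  proof -
    have "A \<union> B = closed_segment d u"
      using q by (auto simp: A_def B_def closed_segment_eq_real_ivl)
    also have "\<dots> \<subseteq> (g ^^ N) ` A'"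
      using cov[of s d "max s t" t N] s t subset_trans[OF A'(1) AX]
      unfolding A'_def by (simp add: A_def)
    finally show ?thesis .
  qed
  moreover have "N \<ge> 1" using n du unfolding N_def by (cases n) auto
  moreover have "compact A'" "compact B" by (auto simp: A'_def B_def)
  ultimately have "horseshoe g X N"
    using A' AX BX covB unfolding horseshoe_def by (intro conjI exI[of _ A'] exI[of _ B]) auto
  then show False using nohs by blast
qed

text \<open>The sign \<open>\<sigma>\<close> treats both sides of \<open>p\<close> at once. If some orbit stays on one side for a step,
  let \<open>V\<close> consist of the points that stay for exactly one step and let \<open>x\<close> be the point of
  \<open>V\<close> closest to \<open>p\<close>. The next return of \<open>y = g x\<close> to \<open>V\<close> is then not closer to \<open>p\<close> than
  \<open>x\<close>, so a power of \<open>g\<close> stretches \<open>[y, p]\<close> over \<open>[x, p]\<close>.\<close>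

lemma side_swapped:
  assumes \<sigma>: "\<sigma> = 1 \<or> \<sigma> = (-1::real)"
    and p: "p \<in> X" "g p = p" "p \<notin> C"
    and mono: "\<And>c. c \<in> C \<Longrightarrow> \<sigma> * c < \<sigma> * p \<Longrightarrow> \<sigma> * c < \<sigma> * g c"
    and other: "c' \<in> C" "\<sigma> * c' > \<sigma> * p"
    and c: "c \<in> C" "\<sigma> * c < \<sigma> * p"
  shows "\<sigma> * g c > \<sigma> * p"
proof (rule ccontr)
  assume neg: "\<not> \<sigma> * g c > \<sigma> * p"
  have gC: "g x \<in> C" if "x \<in> C" for x using min that by (auto simp: minimal_subset_def)
  have ne: "\<sigma> * x \<noteq> \<sigma> * p" if "x \<in> C" for x using p that \<sigma> by auto
  define S where "S = {x. \<sigma> * x < \<sigma> * p}"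
  have S: "open S" "open {x. \<sigma> * x > \<sigma> * p}" unfolding S_def
    by (intro open_Collect_less continuous_intros)+
  have cS: "c \<in> S" "g c \<in> S" unfolding S_def
    using c neg ne[OF gC[OF c(1)]] by (auto simp only: mem_Collect_eq not_less order_le_less)
  obtain n where "(g ^^ n) c \<in> {x. \<sigma> * x > \<sigma> * p}"
    using minimal_subset_visits[OF min c(1) S(2) other(1)] other by auto
  then have ex: "\<exists>n. (g ^^ n) c \<notin> S" by (auto simp: S_def intro: less_asym)
  \<comment> \<open>The first exit time from \<open>S\<close> is at least 2, because
    \<open>c\<close> and \<open>g c\<close> lie in \<open>S\<close>; the orbit point two steps
    before the exit belongs to \<open>V\<close>.\<close>
  define n0 where "n0 = (LEAST n. (g ^^ n) c \<notin> S)"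
  have n0: "(g ^^ n0) c \<notin> S" "\<And>i. i < n0 \<Longrightarrow> (g ^^ i) c \<in> S"
    using LeastI_ex[OF ex] not_less_Least unfolding n0_def by blast+
  have "n0 \<noteq> 0" "n0 \<noteq> 1" using n0(1) cS by (auto intro: ccontr)
  then obtain k where k: "n0 = Suc (Suc k)" by (metis One_nat_def not0_implies_Suc)
  define V where "V = {x\<in>C. x \<in> S \<and> g x \<in> S \<and> g (g x) \<notin> S}"
  have Vne: "(g ^^ k) c \<in> V"
    using n0(2)[of k] n0(2)[of "Suc k"] n0(1) k minimal_subset_funpow_in[OF min c(1)] by (simp add: V_def)
  have contC: "continuous_on C g" "continuous_on C (\<lambda>x. g (g x))"
    using continuous_on_subset[OF cont minimal_set_subset] continuous_on_subset[OF iterate_continuous[of 2] minimal_set_subset]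
    by (simp_all add: numeral_2_eq_2 o_def)
  define T where "T = {x. \<sigma> * x > \<sigma> * p}"
  \<comment> \<open>Since \<open>p \<notin> C\<close>, strict and weak inequalities against
    \<open>p\<close> agree on \<open>C\<close>, so \<open>V\<close> is open and closed in
    \<open>C\<close>. Closedness provides the extreme point \<open>x\<close>, openness the return to
    \<open>V\<close>.\<close>
  have "V = (C \<inter> (\<lambda>x. x) -` S) \<inter> (C \<inter> g -` S) \<inter> (C \<inter> (\<lambda>x. g (g x)) -` T)"
    unfolding V_def S_def T_def using ne gC by (auto simp: not_less order_le_less)
  moreover have "openin (top_of_set C) \<dots>"
    using S contC unfolding T_def
    by (intro openin_Int continuous_openin_preimage_gen continuous_intros) auto
  ultimately obtain W where W: "open W" "V = C \<inter> W" by (auto simp: openin_open)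
  have clS: "closed {x. \<sigma> * x \<le> \<sigma> * p}" "closed {x. \<sigma> * x \<ge> \<sigma> * p}"
    by (intro closed_Collect_le continuous_intros)+
  have "V = (C \<inter> (\<lambda>x. x) -` {x. \<sigma> * x \<le> \<sigma> * p}) \<inter> (C \<inter> g -` {x. \<sigma> * x \<le> \<sigma> * p}) \<inter>
      (C \<inter> (\<lambda>x. g (g x)) -` {x. \<sigma> * x \<ge> \<sigma> * p})"
    unfolding V_def S_def using ne gC by (auto simp: not_less order_le_less)
  moreover have "closed \<dots>"
    using clS contC min
    by (intro closed_Int continuous_closed_preimage continuous_intros) (auto simp: minimal_subset_def)
  ultimately have "closed V" by simp
  then have "compact V" using compact_Int_closed[OF minimal_set_compact, of V] by (simp add: W(2) Int_absorb1)
  then obtain x where x: "x \<in> V" "\<And>v. v \<in> V \<Longrightarrow> \<sigma> * v \<le> \<sigma> * x"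
    using continuous_attains_sup[of V "\<lambda>x. \<sigma> * x"] Vne by (force intro!: continuous_intros)
  define y where "y = g x"
  have xy: "\<sigma> * x < \<sigma> * y" "\<sigma> * y < \<sigma> * p" "\<sigma> * g y > \<sigma> * p" "x \<in> C" "y \<in> C" "g y \<in> C"
    using x(1) mono ne[OF gC[OF gC, of x]] gC by (auto simp: V_def S_def y_def not_less order_le_less)
  obtain n where n: "n \<ge> 1" "(g ^^ n) y \<in> W"
    using minimal_subset_visits[OF min xy(5) W(1)] x(1) W(2) by blast
  then have "(g ^^ n) y \<in> V" using W(2) minimal_subset_funpow_in[OF min xy(5)] by blast
  then have ny: "\<sigma> * (g ^^ n) y \<le> \<sigma> * x" by (rule x(2))
  have inX: "x \<in> X" "y \<in> X" using xy minimal_set_subset by auto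
  have segX: "closed_segment x y \<subseteq> X" "closed_segment y p \<subseteq> X"
    using X(1) inX p by (simp_all add: closed_segment_subset)
  have gp: "(g ^^ n) p = p" for n by (induction n) (auto simp: p)
  \<comment> \<open>The images of \<open>x\<close> and \<open>y\<close> lie on different sides of
    \<open>p\<close>, so some \<open>r\<close> between \<open>x\<close> and \<open>y\<close> is sent
    to \<open>p\<close>. Cutting the segment at \<open>r\<close> leaves a part \<open>B\<close> that
    is disjoint from \<open>A\<close> and still covers it in one step.\<close>
  have "p \<in> closed_segment (g x) (g y)"
    using xy \<sigma> by (auto simp: closed_segment_eq_real_ivl y_def)
  also have "\<dots> \<subseteq> g ` closed_segment x y"
    using segX by (intro closed_segment_subset_image[OF cont]) auto
  finally obtain r where r: "r \<in> closed_segment x y" "g r = p" by blast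
  have "r \<noteq> y" using xy r by auto
  define A where "A = closed_segment y p"
  define B where "B = closed_segment x r"
  have r2: "\<sigma> * x \<le> \<sigma> * r" "\<sigma> * r < \<sigma> * y" 
    using r \<open>r \<noteq> y\<close> \<sigma> xy by (auto simp: closed_segment_eq_real_ivl split: if_splits)
  have AB: "A \<inter> B = {}" "A \<noteq> {}" "A \<subseteq> X" "B \<subseteq> X"
    unfolding A_def B_def using r2 xy \<sigma> segX inX X
    by (auto simp: closed_segment_eq_real_ivl subset_iff split: if_splits)
  have hull: "A \<union> B \<subseteq> closed_segment x p"
    using r2 xy \<sigma> by (auto simp: A_def B_def closed_segment_eq_real_ivl split: if_splits)
  also have "\<dots> \<subseteq> closed_segment ((g ^^ n) y) ((g ^^ n) p)"
    using ny \<sigma> xy by (auto simp: gp closed_segment_eq_real_ivl split: if_splits)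
  also have "\<dots> \<subseteq> (g ^^ n) ` A"
    unfolding A_def using segX by (intro closed_segment_subset_image[OF iterate_continuous]) auto
  finally have covA: "A \<union> B \<subseteq> (g ^^ n) ` A" .
  have "A = closed_segment (g x) (g r)" by (simp add: A_def r y_def)
  also have "\<dots> \<subseteq> g ` B"
    unfolding B_def using AB by (intro closed_segment_subset_image[OF cont]) (auto simp: B_def)
  finally have "(g ^^ n) ` A \<subseteq> (g ^^ n) ` (g ` B)" by blast
  also have "\<dots> = (g ^^ Suc n) ` B" by (simp only: funpow_Suc_right image_comp)
  finally have "(g ^^ n) ` A \<subseteq> (g ^^ Suc n) ` B" .
  then have covB: "A \<union> B \<subseteq> (g ^^ Suc n) ` B" using covA by blast
  have "horseshoe g X (n * Suc n)"
    using n AB covA covB by (intro horseshoeI[of n "Suc n" A B]) (auto simp: A_def B_def)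
  then show False using nohs by blast
qed

text \<open>All rising points of \<open>C\<close> lie below all falling ones, so a fixed point
  \<open>p\<close> fits between the largest rising and the smallest falling point. Both sides then
  move towards \<open>p\<close>, and \<open>side_swapped\<close> with either sign makes them jump
  across.\<close>

lemma minimal_set_swapped:
  assumes "z \<in> C" "z' \<in> C" "z \<noteq> z'"
  obtains p where "p \<notin> C" "\<And>x. x \<in> C \<Longrightarrow> x < p \<longleftrightarrow> g x > p"
proof -
  have gC: "g x \<in> C" if "x \<in> C" for x using min that by (auto simp: minimal_subset_def)
  have nofix: "g x \<noteq> x" if "x \<in> C" for x
    using minimal_subset_no_fixpoint[OF min that] assms by metis
  have contC: "continuous_on C g" using cont minimal_set_subset continuous_on_subset by blast
  have clC: "closed C" using minimal_set_compact by (rule compact_imp_closed)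
  define U where "U = C \<inter> (\<lambda>x. g x - x) -` {0..}"
  define D where "D = C \<inter> (\<lambda>x. g x - x) -` {..0}"
  have "closed U" "closed D" unfolding U_def D_def
    by (intro continuous_closed_preimage continuous_intros contC clC closed_atLeast closed_atMost)+
  then have compact: "compact U" "compact D"
    using compact_Int_closed[OF minimal_set_compact] by (metis U_def D_def inf.left_idem)+
  obtain m where m: "m \<in> C" "\<And>x. x \<in> C \<Longrightarrow> m \<le> x" using compact_attains_inf[OF minimal_set_compact] assms by blast
  obtain m' where m': "m' \<in> C" "\<And>x. x \<in> C \<Longrightarrow> x \<le> m'" using compact_attains_sup[OF minimal_set_compact] assms by blast
  \<comment> \<open>The least point of \<open>C\<close> cannot move down and the greatest cannot
    move up, so both classes are nonempty.\<close>
  have ne: "m \<in> U" "m' \<in> D" using m m' gC by (auto simp: U_def D_def)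
  obtain u where u: "u \<in> U" "\<And>x. x \<in> U \<Longrightarrow> x \<le> u" using compact_attains_sup[OF compact(1)] ne by blast
  obtain d where d: "d \<in> D" "\<And>x. x \<in> D \<Longrightarrow> d \<le> x" using compact_attains_inf[OF compact(2)] ne by blast
  have up: "g u > u" "g d < d" "u \<in> C" "d \<in> C"
    using u d nofix by (auto simp: U_def D_def order_le_less)
  have ud: "u < d" using rising_below_falling up by blast
  have "{u..d} \<subseteq> X" using closed_segment_subset[OF _ _ X(1), of u d] up minimal_set_subset ud
    by (auto simp: closed_segment_eq_real_ivl)
  then have "\<exists>q. u \<le> q \<and> q \<le> d \<and> g q - q = 0"
    using up ud by (intro IVT2' continuous_intros continuous_on_subset[OF cont]) auto
  then obtain p where p: "u \<le> p" "p \<le> d" "g p = p" by auto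
  have pX: "p \<in> X" using p \<open>{u..d} \<subseteq> X\<close> by auto
  have pC: "p \<notin> C" using nofix p by blast
  have side: "x < p \<Longrightarrow> x < g x" "x > p \<Longrightarrow> g x < x" if "x \<in> C" for x
    using that u(2)[of x] d(2)[of x] p by (force simp: U_def D_def)+
  have "u < p" "p < d" using p pC up by (auto simp: order_le_less)
  then have "g x > p" if "x \<in> C" "x < p" for x
    using side_swapped[of 1 p d x] that side p pX pC up by auto
  moreover have "g x < p" if "x \<in> C" "x > p" for x
    using side_swapped[of "-1" p u x] that side p pX pC up \<open>u < p\<close> by auto
  ultimately show ?thesis using that[of p] pC
    by (metis less_asym linorder_neqE)
qed

end

section \<open>Cyclic decompositions of a minimal set\<close>

text \<open>The two residues modulo \<open>2 * k\<close> over one residue modulo \<open>k\<close>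
  differ in the parity of the quotient by \<open>k\<close>, which adding \<open>k\<close>
  flips.\<close>

lemma mod_double_shift:
  fixes i j k :: nat
  assumes "i mod (2 * k) \<noteq> j mod (2 * k)" "i mod k = j mod k"
  shows "j mod (2 * k) = (i + k) mod (2 * k)"
proof -
  have *: "n mod (2 * k) = k * (n div k mod 2) + n mod k" for n
    by (simp add: mod_mult2_eq mult.commute[of 2])
  show ?thesis
  proof (cases "k = 0")
    case False
    then have "(i + k) div k = Suc (i div k)" "(i + k) mod k = i mod k" by simp_all
    then show ?thesis using assms unfolding *
      by (simp add: mod_Suc) (metis mod2_eq_if not_mod2_eq_Suc_0_eq_0)
  qed (use assms in auto)
qed

section \<open>Pieces of a minimal set along residue classes of times\<close>

locale minimal_orbit =
  fixes X :: "real set" and f :: "real \<Rightarrow> real" and K :: "real set" and x0 :: real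
  assumes cont: "continuous_on X f" and inv: "f ` X \<subseteq> X"
    and min: "minimal_subset X f K" and x0: "x0 \<in> K"
begin

text \<open>Built from the orbit rather than from cutting points, so that the pieces are permuted
  cyclically from the outset and only their separation has to be proved. Any natural number is an
  index, which spares reductions modulo \<open>k\<close>.\<close>

definition piece :: "nat \<Rightarrow> nat \<Rightarrow> real set" where
  "piece k i = closure ((\<lambda>n. (f ^^ n) x0) ` {n. n mod k = i mod k})"

lemma K_X: "K \<subseteq> X" using min by (simp add: minimal_subset_def)

lemma orbit_in_K: "(f ^^ n) x0 \<in> K" by (rule minimal_subset_funpow_in[OF min x0])

lemma closed_piece: "closed (piece k i)" by (simp add: piece_def)

lemma piece_subset: "piece k i \<subseteq> K"
  unfolding piece_def using min orbit_in_K by (intro closure_minimal) (auto simp: minimal_subset_def)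

lemma orbit_in_piece: "n mod k = i mod k \<Longrightarrow> (f ^^ n) x0 \<in> piece k i"
  unfolding piece_def by (intro subsetD[OF closure_subset]) auto

lemma piece_cong: "i mod k = j mod k \<Longrightarrow> piece k i = piece k j"
  by (simp add: piece_def)

lemma f_piece:
  assumes "x \<in> piece k i"
  shows "f x \<in> piece k (Suc i)"
proof -
  have "f ` closure ((\<lambda>n. (f ^^ n) x0) ` {n. n mod k = i mod k}) \<subseteq> piece k (Suc i)"
  proof (rule image_closure_subset)
    show "continuous_on (closure ((\<lambda>n. (f ^^ n) x0) ` {n. n mod k = i mod k})) f"
      using continuous_on_subset[OF cont] piece_subset[of k i] K_X by (auto simp: piece_def)
    show "f ` (\<lambda>n. (f ^^ n) x0) ` {n. n mod k = i mod k} \<subseteq> piece k (Suc i)"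
      by (auto intro!: orbit_in_piece[of "Suc n" for n, simplified] intro: mod_Suc_eq[THEN trans]
          simp: mod_Suc)
  qed (rule closed_piece)
  then show ?thesis using assms by (auto simp: piece_def)
qed

lemma funpow_piece:
  assumes "x \<in> piece k i"
  shows "(f ^^ m) x \<in> piece k (i + m)"
proof (induction m)
  case (Suc m)
  then show ?case using f_piece[OF Suc] by simp
qed (simp add: assms)

text \<open>A finite union of pieces is closed and contains the orbit, hence also its closure
  \<open>K\<close>.\<close>

lemma K_covered:
  assumes "k \<ge> 1" "x \<in> K"
  obtains i where "i < k" "x \<in> piece k i"
proof -
  have "closure {(f ^^ n) x0 | n. n \<ge> 1} \<subseteq> (\<Union>i<k. piece k i)"
  proof (intro closure_minimal closed_UN)
    show "{(f ^^ n) x0 | n. n \<ge> 1} \<subseteq> (\<Union>i<k. piece k i)"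
    proof clarify
      fix n :: nat
      show "(f ^^ n) x0 \<in> (\<Union>i<k. piece k i)"
        using assms orbit_in_piece[of n k "n mod k"] by (intro UN_I[of "n mod k"]) auto
    qed
  qed (auto simp: closed_piece)
  then show ?thesis using that min x0 assms unfolding minimal_subset_def by blast
qed

lemma piece_refine: "k dvd l \<Longrightarrow> piece l i \<subseteq> piece k i"
  unfolding piece_def
proof (intro closure_mono image_mono Collect_mono impI)
  fix n assume "k dvd l" "n mod l = i mod l"
  then show "n mod k = i mod k" using mod_mod_cancel[of k l n] mod_mod_cancel[of k l i] by simp
qed

text \<open>Separation in the order, stronger than disjointness: it makes the pieces order-convex in
  \<open>K\<close>. The bound \<open>k \<ge> 1\<close> excludes \<open>mod 0\<close>, where every
  time is a class of its own.\<close>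

definition separated :: "nat \<Rightarrow> bool" where
  "separated k \<longleftrightarrow> k \<ge> 1 \<and> (\<forall>i j. i mod k \<noteq> j mod k \<longrightarrow>
     (\<forall>x\<in>piece k i. \<forall>y\<in>piece k j. x < y) \<or> (\<forall>x\<in>piece k i. \<forall>y\<in>piece k j. y < x))"

lemma separated_1: "separated (Suc 0)"
  by (simp add: separated_def)

lemma separated_pos: "separated k \<Longrightarrow> k \<ge> 1"
  by (simp add: separated_def)

lemma separated_unique:
  assumes "separated k" "x \<in> piece k i" "x \<in> piece k j"
  shows "i mod k = j mod k"
proof (rule ccontr)
  assume "i mod k \<noteq> j mod k"
  then have "x < x \<or> x < x" using assms unfolding separated_def by blast
  then show False by simp
qed

text \<open>If the orbit of \<open>x\<close> under \<open>f ^^ k\<close> stayed away from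
  \<open>y\<close>, its closure and the other pieces would form a closed set \<open>F\<close>
  without \<open>y\<close>. The orbit under \<open>f\<close> leaves \<open>F\<close> at some time
  \<open>n\<close>; being then in the piece of \<open>x\<close> forces \<open>k dvd n\<close>, so
  the point belongs to the orbit under \<open>f ^^ k\<close> after all.\<close>

lemma piece_funpow_minimal:
  assumes k: "separated k"
  shows "minimal_subset X (f ^^ k) (piece k i)"
proof -
  have inv_piece: "((f ^^ k) ^^ n) x \<in> piece k i" if "x \<in> piece k i" for n x
    using funpow_piece[OF that, of "k * n"] piece_cong[of "i + k * n" k i] by (simp add: funpow_mult)
  have "closure {((f ^^ k) ^^ n) x | n. n \<ge> 1} = piece k i" (is "?O = _") if x: "x \<in> piece k i" for x
  proof
    show "?O \<subseteq> piece k i"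
      using inv_piece[OF x] closed_piece by (intro closure_minimal) auto
    show "piece k i \<subseteq> ?O"
    proof (rule subsetI, rule ccontr)
      fix y assume y: "y \<in> piece k i" "y \<notin> ?O"
      define J where "J = {..<k} - {i mod k}"
      define F where "F = ?O \<union> (\<Union>j\<in>J. piece k j)"
      have "closed F" unfolding F_def J_def by (intro closed_Un closed_UN) (auto simp: closed_piece)
      moreover have "y \<notin> piece k j" if "j \<in> J" for j
        using separated_unique[OF k y(1), of j] that unfolding J_def by auto
      then have "y \<notin> F" using y(2) by (auto simp: F_def)
      ultimately obtain n where n: "n \<ge> 1" "(f ^^ n) x \<in> - F"
        using minimal_subset_visits[OF min, of x "-F" y] subsetD[OF piece_subset x] subsetD[OF piece_subset y(1)]
        by (auto simp: open_Compl)
      have "(f ^^ n) x \<in> piece k ((i + n) mod k)"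
        using funpow_piece[OF x, of n] piece_cong[of "(i + n) mod k" k "i + n"] by simp
      then have "(i + n) mod k \<notin> J" using n by (auto simp: F_def)
      then have "(i + n) mod k = (i + 0) mod k" using separated_pos[OF k] by (auto simp: J_def)
      then have "k dvd n" using mod_eq_dvd_iff_nat[of i "i + n" k] by simp
      then obtain m where "n = k * m" by blast
      then have "(f ^^ n) x = ((f ^^ k) ^^ m) x" "m \<ge> 1" using n by (auto simp: funpow_mult intro: Suc_leI gr0I)
      then have "(f ^^ n) x \<in> ?O" by (intro subsetD[OF closure_subset]) auto
      then show False using n by (auto simp: F_def)
    qed
  qed
  moreover have "(f ^^ k) ` piece k i \<subseteq> piece k i" using inv_piece[of _ 1] by auto
  ultimately show ?thesis
    unfolding minimal_subset_def using closed_piece piece_subset[of k i] K_X by blast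
qed

text \<open>A one-point piece is fixed by \<open>f ^^ k\<close>; its images under \<open>f\<close>
  are fixed as well and reach every other piece, which is minimal for \<open>f ^^ k\<close> and so
  also a single point.\<close>

lemma trivial_piece:
  assumes k: "separated k" and c: "piece k i \<subseteq> {c}"
  shows "\<exists>c. piece k j \<subseteq> {c}"
proof (rule ccontr)
  assume nt: "\<not> ?thesis"
  have ci: "c \<in> piece k i" using c orbit_in_piece[of i k i] by blast
  have "(f ^^ k) c \<in> piece k i"
    using funpow_piece[OF ci, of k] piece_cong[of "i + k" k i] by simp
  then have fix_c: "(f ^^ k) c = c" using c by blast
  \<comment> \<open>A natural number congruent to \<open>j - i\<close> modulo \<open>k\<close>,
    chosen without subtracting \<open>i\<close>.\<close>
  define m where "m = j + (k - 1) * i"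
  have "i + m = j + k * i" using separated_pos[OF k] by (cases k) (simp_all add: m_def)
  then have "(f ^^ m) c \<in> piece k j"
    using funpow_piece[OF ci, of m] piece_cong[of "i + m" k j] by simp
  moreover have "(f ^^ k) ((f ^^ m) c) = (f ^^ m) c"
    using fix_c by (metis add.commute comp_apply funpow_add)
  moreover have "\<exists>z. z \<in> piece k j \<and> z \<noteq> (f ^^ m) c" using nt by blast
  ultimately show False
    using minimal_subset_no_fixpoint[OF piece_funpow_minimal[OF k]] by metis
qed

text \<open>Two swaps about \<open>p\<close> cancel, so the orbit points at times congruent to
  \<open>i\<close> modulo \<open>2 * k\<close> stay on the side of the first of them,
  \<open>y\<close>. The closure could only add \<open>p\<close>, which is not in the piece.\<close>

lemma half_piece_one_sided:
  assumes p: "p \<notin> piece k i" "\<And>x. x \<in> piece k i \<Longrightarrow> x < p \<longleftrightarrow> (f ^^ k) x > p"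
  shows "piece (2 * k) i \<subseteq> {..<p} \<or> piece (2 * k) i \<subseteq> {p<..}"
proof -
  define y where "y = (f ^^ (i mod (2 * k))) x0"
  have modk: "i mod (2 * k) mod k = i mod k" by (simp add: mod_mod_cancel)
  have side: "(f ^^ (2 * k * j)) y < p \<longleftrightarrow> y < p" for j
  proof (induction j)
    case (Suc j)
    define z where "z = (f ^^ (2 * k * j)) y"
    have "z = (f ^^ (2 * k * j + i mod (2 * k))) x0" by (simp add: z_def y_def funpow_add)
    moreover have "(2 * k * j + i mod (2 * k)) mod k = i mod k"
      using modk by (metis add.commute mod_mult_self2 mult.assoc mult.commute)
    ultimately have z: "z \<in> piece k i" by (simp add: orbit_in_piece)
    then have fz: "(f ^^ k) z \<in> piece k i"
      using funpow_piece[OF z, of k] piece_cong[of "i + k" k i] by simp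
    then have ffz: "(f ^^ k) ((f ^^ k) z) \<in> piece k i"
      using funpow_piece[OF fz, of k] piece_cong[of "i + k" k i] by simp
    have "2 * k * Suc j = k + (k + 2 * k * j)" by simp
    then have "(f ^^ (2 * k * Suc j)) y = (f ^^ k) ((f ^^ k) z)" by (simp only: funpow_add z_def o_apply)
    then show ?case using p(2)[OF z] p(2)[OF fz] p(1) ffz fz Suc unfolding z_def
      by (metis less_asym linorder_neqE)
  qed simp
  have orb: "\<exists>j. (f ^^ n) x0 = (f ^^ (2 * k * j)) y" if "n mod (2 * k) = i mod (2 * k)" for n
  proof -
    have "n = 2 * k * (n div (2 * k)) + i mod (2 * k)" by (metis that mult_div_mod_eq)
    then have "(f ^^ n) x0 = (f ^^ (2 * k * (n div (2 * k)))) y"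
      unfolding y_def by (metis comp_apply funpow_add)
    then show ?thesis by blast
  qed
  have p2: "p \<notin> piece (2 * k) i" using piece_refine[of k "2 * k" i] p by auto
  show ?thesis
  proof (cases "y < p")
    case True
    have "piece (2 * k) i \<subseteq> {..p}" unfolding piece_def
      using orb side True by (intro closure_minimal) (auto, metis less_imp_le)
    then show ?thesis using p2 by (auto simp: order_le_less)
  next
    case False
    have "piece (2 * k) i \<subseteq> {p..}" unfolding piece_def
      using orb side False by (intro closure_minimal) (auto, metis not_less)
    then show ?thesis using p2 by (auto simp: order_le_less)
  qed
qed

text \<open>Indices that differ modulo \<open>k\<close> are separated already. The two halves of one
  piece are each one-sided about the point \<open>p\<close> of \<open>minimal_set_swapped\<close>,
  and a single orbit point with its swapped image shows that the sides are opposite.\<close>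

lemma separated_double:
  assumes X: "convex X" "compact X" and nohs: "\<And>n. \<not> horseshoe f X n"
    and k: "separated k" and nt: "\<nexists>c. piece k 0 \<subseteq> {c}"
  shows "separated (2 * k)"
proof -
  have k1: "k \<ge> 1" by (rule separated_pos[OF k])
  have opposite: "(\<forall>x\<in>piece (2 * k) i. \<forall>y\<in>piece (2 * k) (i + k). x < y) \<or>
      (\<forall>x\<in>piece (2 * k) i. \<forall>y\<in>piece (2 * k) (i + k). y < x)" for i
  proof -
    have "\<nexists>c. piece k i \<subseteq> {c}" using trivial_piece[OF k] nt by blast
    then obtain z z' where z: "z \<in> piece k i" "z' \<in> piece k i" "z \<noteq> z'"
      using orbit_in_piece[of i k i] by blast
    have "\<not> horseshoe (f ^^ k) X n" for n using horseshoe_funpow[OF _ k1] nohs by blast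
    then obtain p where p: "p \<notin> piece k i" "\<And>x. x \<in> piece k i \<Longrightarrow> x < p \<longleftrightarrow> (f ^^ k) x > p"
      using minimal_set_swapped[OF X continuous_on_funpow_invariant[OF cont inv] _ piece_funpow_minimal[OF k] _ z]
        funpow_invariant[OF inv] by (metis image_subsetI)
    have eq: "piece k (i + k) = piece k i" by (rule piece_cong) simp
    have sides: "piece (2 * k) i \<subseteq> {..<p} \<or> piece (2 * k) i \<subseteq> {p<..}"
      "piece (2 * k) (i + k) \<subseteq> {..<p} \<or> piece (2 * k) (i + k) \<subseteq> {p<..}"
      using half_piece_one_sided[of p k i] half_piece_one_sided[of p k "i + k"] p eq by blast+
    have x: "(f ^^ i) x0 \<in> piece (2 * k) i" by (rule orbit_in_piece) simp
    have x': "(f ^^ k) ((f ^^ i) x0) \<in> piece (2 * k) (i + k)" by (rule funpow_piece[OF x])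
    have "(f ^^ i) x0 \<in> piece k i" by (rule orbit_in_piece) simp
    then have "(f ^^ i) x0 < p \<longleftrightarrow> (f ^^ k) ((f ^^ i) x0) > p" by (rule p(2))
    with sides x x' show ?thesis
      by (meson greaterThan_iff lessThan_iff less_asym less_trans subsetD)
  qed
  show ?thesis
    unfolding separated_def
  proof (intro conjI allI impI)
    show "2 * k \<ge> 1" using k1 by simp
    fix i j assume ij: "i mod (2 * k) \<noteq> j mod (2 * k)"
    show "(\<forall>x\<in>piece (2 * k) i. \<forall>y\<in>piece (2 * k) j. x < y) \<or>
        (\<forall>x\<in>piece (2 * k) i. \<forall>y\<in>piece (2 * k) j. y < x)"
    proof (cases "i mod k = j mod k")
      case False
      then show ?thesis
        using k piece_refine[of k "2 * k" i] piece_refine[of k "2 * k" j] unfolding separated_def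
        by (meson dvd_triv_right subsetD)
    next
      case True
      have "j mod (2 * k) = (i + k) mod (2 * k)"
        by (rule mod_double_shift[OF ij True])
      then show ?thesis using opposite[of i] piece_cong[of j "2 * k" "i + k"] by simp
    qed
  qed
qed

text \<open>Doubling can stop only at one-point pieces; the second alternative is the case of a
  finite cycle \<open>K\<close>.\<close>

lemma separated_tower:
  assumes X: "convex X" "compact X" and nohs: "\<And>n. \<not> horseshoe f X n"
  shows "(\<forall>n. separated (2 ^ n)) \<or> (\<exists>n. separated (2 ^ n) \<and> (\<forall>i. \<exists>c. piece (2 ^ n) i \<subseteq> {c}))"
proof (rule disjCI)
  assume *: "\<nexists>n. separated (2 ^ n) \<and> (\<forall>i. \<exists>c. piece (2 ^ n) i \<subseteq> {c})"
  show "\<forall>n. separated (2 ^ n)"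
  proof
    fix n show "separated (2 ^ n)"
    proof (induction n)
      case (Suc n)
      have "\<nexists>c. piece (2 ^ n) 0 \<subseteq> {c}" using * Suc trivial_piece[OF Suc] by blast
      then show ?case using separated_double[OF X nohs Suc] by simp
    qed (simp add: separated_1)
  qed
qed

text \<open>For separated \<open>k\<close> this is the factor map from \<open>K\<close> to the
  rotation by one on the integers modulo \<open>k\<close>. Outside \<open>K\<close> the value is
  unspecified.\<close>

definition addr :: "nat \<Rightarrow> real \<Rightarrow> nat" where
  "addr k x = (THE i. i < k \<and> x \<in> piece k i)"

lemma addr_eqI:
  assumes "separated k" "x \<in> piece k i"
  shows "addr k x = i mod k"
  unfolding addr_def
proof (rule the_equality)
  show "i mod k < k \<and> x \<in> piece k (i mod k)"
    using assms separated_pos[OF assms(1)] piece_cong[of "i mod k" k i] by simp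
  fix j assume "j < k \<and> x \<in> piece k j"
  then show "j = i mod k" using separated_unique[OF assms, of j] by simp
qed

lemma addr:
  assumes "separated k" "x \<in> K"
  shows "addr k x < k" "x \<in> piece k (addr k x)"
proof -
  obtain i where i: "i < k" "x \<in> piece k i" using K_covered[OF separated_pos] assms by metis
  then show "addr k x < k" "x \<in> piece k (addr k x)" using addr_eqI[OF assms(1) i(2)] by auto
qed

lemma addr_f:
  assumes "separated k" "x \<in> K"
  shows "addr k (f x) = Suc (addr k x) mod k"
  using addr_eqI[OF assms(1) f_piece[OF addr(2)[OF assms]]] .

lemma addr_refine:
  assumes "separated k" "separated l" "k dvd l" "x \<in> K"
  shows "addr k x = addr l x mod k"
  using addr_eqI[OF assms(1)] addr(2)[OF assms(2,4)] piece_refine[OF assms(3)] by blast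

end

section \<open>Approximation in the space of square-integrable functions\<close>

inductive_set cspan :: "('a \<Rightarrow> complex) set \<Rightarrow> ('a \<Rightarrow> complex) set" for B where
  cspan_zero: "(\<lambda>x. 0) \<in> cspan B"
| cspan_step: "h \<in> B \<Longrightarrow> g \<in> cspan B \<Longrightarrow> (\<lambda>x. c * h x + g x) \<in> cspan B"

lemma cspan_base:
  assumes "h \<in> B"
  shows "h \<in> cspan B"
  using cspan_step[OF assms cspan_zero, of 1] by simp

lemma cspan_add:
  assumes "g \<in> cspan B" "h \<in> cspan B"
  shows "(\<lambda>x. g x + h x) \<in> cspan B"
  using assms by (induction g rule: cspan.induct) (simp_all add: add.assoc cspan_step)

lemma cspan_scale:
  assumes "g \<in> cspan B"
  shows "(\<lambda>x. c * g x) \<in> cspan B"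
  using assms
proof (induction rule: cspan.induct)
  case (cspan_step h g a)
  then show ?case using cspan.cspan_step[of h B _ "c * a"] by (simp add: distrib_left mult.assoc)
qed (simp add: cspan.cspan_zero)

lemma cspan_sum:
  assumes "finite I" "\<And>i. i \<in> I \<Longrightarrow> g i \<in> cspan B"
  shows "(\<lambda>x. \<Sum>i\<in>I. g i x) \<in> cspan B"
  using assms by (induction I rule: finite_induct) (simp_all add: cspan_zero cspan_add)

text \<open>Yields the form used in \<open>L2_orthonormal_basis\<close>. That sum runs over a set,
  so a repeated function has its coefficients added up.\<close>

lemma cspan_finite_sum:
  assumes "g \<in> cspan B"
  shows "\<exists>F c. finite F \<and> F \<subseteq> B \<and> g = (\<lambda>x. \<Sum>h\<in>F. c h * h x)"
  using assms
proof (induction rule: cspan.induct)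
  case cspan_zero
  show ?case by (intro exI[of _ "{}"]) simp
next
  case (cspan_step h g a)
  then obtain F c where F: "finite F" "F \<subseteq> B" "g = (\<lambda>x. \<Sum>h\<in>F. c h * h x)" by blast
  define c' where "c' = (\<lambda>k. (if k \<in> F then c k else 0) + (if k = h then a else 0))"
  have "(\<Sum>k\<in>insert h F. c' k * k x) = a * h x + g x" for x
  proof -
    have "(\<Sum>k\<in>insert h F. c' k * k x) =
        (\<Sum>k\<in>insert h F. if k \<in> F then c k * k x else 0) + (\<Sum>k\<in>insert h F. if k = h then a * k x else 0)"
      unfolding sum.distrib[symmetric] c'_def by (intro sum.cong) (auto simp: algebra_simps)
    also have "(\<Sum>k\<in>insert h F. if k \<in> F then c k * k x else 0) = (\<Sum>k\<in>F. c k * k x)"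
      using F(1) by (intro sum.mono_neutral_cong_right) auto
    also have "(\<Sum>k\<in>insert h F. if k = h then a * k x else 0) = a * h x"
      using F(1) by (simp add: sum.delta)
    finally show ?thesis by (simp add: F(3))
  qed
  then show ?case using F cspan_step(1) by (intro exI[of _ "insert h F"] exI[of _ c']) auto
qed

text \<open>Replaces the Minkowski inequality: with the factor 2, two errors below
  \<open>e / 4\<close> in squared norm add up to less than \<open>e\<close>.\<close>

lemma cmod_add_sq_le: "(cmod (a + b))\<^sup>2 \<le> 2 * (cmod a)\<^sup>2 + 2 * (cmod b)\<^sup>2"
proof -
  have "(cmod (a + b))\<^sup>2 \<le> (cmod a + cmod b)\<^sup>2" by (intro power_mono norm_triangle_ineq) auto
  also have "\<dots> \<le> 2 * (cmod a)\<^sup>2 + 2 * (cmod b)\<^sup>2"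
    using sum_squares_bound[of "cmod a" "cmod b"] by (simp add: power2_sum)
  finally show ?thesis .
qed

section \<open>Square-integrable functions and closed spans\<close>

lemma L2_measurable: "g \<in> L2 M \<Longrightarrow> g \<in> borel_measurable M"
  by (simp add: L2_def)

lemma L2_integrable: "g \<in> L2 M \<Longrightarrow> integrable M (\<lambda>x. (cmod (g x))\<^sup>2)"
  by (simp add: L2_def)

lemma L2_add:
  assumes "g \<in> L2 M" "h \<in> L2 M"
  shows "(\<lambda>x. g x + h x) \<in> L2 M"
proof -
  note [measurable] = assms[THEN L2_measurable]
  have "integrable M (\<lambda>x. (cmod (g x + h x))\<^sup>2)"
    by (rule Bochner_Integration.integrable_bound[of M "\<lambda>x. 2 * (cmod (g x))\<^sup>2 + 2 * (cmod (h x))\<^sup>2"])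
      (use assms[THEN L2_integrable] in \<open>auto simp: cmod_add_sq_le\<close>)
  then show ?thesis by (simp add: L2_def)
qed

lemma L2_scale:
  assumes "g \<in> L2 M"
  shows "(\<lambda>x. c * g x) \<in> L2 M"
  using assms by (auto simp: L2_def norm_mult power_mult_distrib)

lemma L2_diff:
  assumes "g \<in> L2 M" "h \<in> L2 M"
  shows "(\<lambda>x. g x - h x) \<in> L2 M"
  using L2_add[OF assms(1) L2_scale[OF assms(2), of "-1"]] by simp

lemma L2_sq_add_le:
  assumes "g \<in> L2 M" "h \<in> L2 M"
  shows "(LINT x|M. (cmod (g x + h x))\<^sup>2) \<le> 2 * (LINT x|M. (cmod (g x))\<^sup>2) + 2 * (LINT x|M. (cmod (h x))\<^sup>2)"
proof -
  have "(LINT x|M. (cmod (g x + h x))\<^sup>2) \<le> (LINT x|M. 2 * (cmod (g x))\<^sup>2 + 2 * (cmod (h x))\<^sup>2)"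
    using assms L2_add[OF assms] by (intro integral_mono) (auto simp: L2_integrable cmod_add_sq_le)
  also have "\<dots> = 2 * (LINT x|M. (cmod (g x))\<^sup>2) + 2 * (LINT x|M. (cmod (h x))\<^sup>2)"
    using assms by (simp add: L2_integrable)
  finally show ?thesis .
qed

lemma (in finite_measure) L2_bounded:
  assumes "g \<in> borel_measurable M" "\<And>x. x \<in> space M \<Longrightarrow> cmod (g x) \<le> b"
  shows "g \<in> L2 M"
proof -
  have "AE x in M. norm ((cmod (g x))\<^sup>2) \<le> b\<^sup>2"
    using assms(2) by (intro AE_I2) (auto intro: power_mono)
  then have "integrable M (\<lambda>x. (cmod (g x))\<^sup>2)"
    using assms(1) by (intro integrable_const_bound[of _ "b\<^sup>2"]) auto
  then show ?thesis using assms(1) by (simp add: L2_def)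
qed

text \<open>The closed linear span of \<open>B\<close>, measured by the squared norm to keep square
  roots out of the estimates.\<close>

definition l2_closure :: "'a measure \<Rightarrow> ('a \<Rightarrow> complex) set \<Rightarrow> ('a \<Rightarrow> complex) set" where
  "l2_closure M B = {g \<in> L2 M. \<forall>e>0. \<exists>v\<in>cspan B. (LINT x|M. (cmod (g x - v x))\<^sup>2) < e}"

context
  fixes M :: "'a measure" and B :: "('a \<Rightarrow> complex) set"
  assumes B: "B \<subseteq> L2 M"
begin

lemma cspan_L2: "g \<in> cspan B \<Longrightarrow> g \<in> L2 M"
proof (induction rule: cspan.induct)
  case cspan_zero
  show ?case by (simp add: L2_def)
qed (use B in \<open>auto intro!: L2_add L2_scale\<close>)

lemma cspan_l2_closure: "g \<in> cspan B \<Longrightarrow> g \<in> l2_closure M B"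
  unfolding l2_closure_def by (auto intro!: cspan_L2 bexI[of _ g])

lemma l2_closure_add:
  assumes "g \<in> l2_closure M B" "h \<in> l2_closure M B"
  shows "(\<lambda>x. g x + h x) \<in> l2_closure M B"
proof -
  have L: "g \<in> L2 M" "h \<in> L2 M" using assms by (auto simp: l2_closure_def)
  have "\<exists>v\<in>cspan B. (LINT x|M. (cmod (g x + h x - v x))\<^sup>2) < e" if "e > 0" for e
  proof -
    have e: "e / 4 > 0" using that by simp
    obtain v where v: "v \<in> cspan B" "(LINT x|M. (cmod (g x - v x))\<^sup>2) < e / 4"
      using assms e unfolding l2_closure_def by blast
    obtain w where w: "w \<in> cspan B" "(LINT x|M. (cmod (h x - w x))\<^sup>2) < e / 4"
      using assms e unfolding l2_closure_def by blast
    have "(LINT x|M. (cmod ((g x - v x) + (h x - w x)))\<^sup>2) \<le>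
        2 * (LINT x|M. (cmod (g x - v x))\<^sup>2) + 2 * (LINT x|M. (cmod (h x - w x))\<^sup>2)"
      by (intro L2_sq_add_le L2_diff L cspan_L2 v w)
    also have "\<dots> < e" using v w by simp
    finally have "(LINT x|M. (cmod (g x + h x - (v x + w x)))\<^sup>2) < e" by (simp add: algebra_simps)
    then show ?thesis using cspan_add[OF v(1) w(1)] by (rule bexI[of _ "\<lambda>x. v x + w x"])
  qed
  then show ?thesis using L2_add[OF L] by (simp add: l2_closure_def)
qed

lemma l2_closure_scale:
  assumes "g \<in> l2_closure M B"
  shows "(\<lambda>x. c * g x) \<in> l2_closure M B"
proof (cases "c = 0")
  case True
  then show ?thesis using cspan_l2_closure[OF cspan_zero] by simp
next
  case False
  have "\<exists>v\<in>cspan B. (LINT x|M. (cmod (c * g x - v x))\<^sup>2) < e" if "e > 0" for e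
  proof -
    have "e / (cmod c)\<^sup>2 > 0" using that False by simp
    then obtain v where v: "v \<in> cspan B" "(LINT x|M. (cmod (g x - v x))\<^sup>2) < e / (cmod c)\<^sup>2"
      using assms unfolding l2_closure_def by blast
    have "(LINT x|M. (cmod (c * g x - c * v x))\<^sup>2) = (cmod c)\<^sup>2 * (LINT x|M. (cmod (g x - v x))\<^sup>2)"
      unfolding right_diff_distrib[symmetric] norm_mult power_mult_distrib by simp
    also have "\<dots> < e" using v(2) False by (simp add: field_simps)
    finally show ?thesis using cspan_scale[OF v(1), of c] by (rule bexI[of _ "\<lambda>x. c * v x"])
  qed
  then show ?thesis using assms L2_scale by (auto simp: l2_closure_def)
qed

lemma l2_closure_sum:
  assumes "finite I" "\<And>i. i \<in> I \<Longrightarrow> g i \<in> l2_closure M B"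
  shows "(\<lambda>x. \<Sum>i\<in>I. g i x) \<in> l2_closure M B"
  using assms by (induction I rule: finite_induct)
    (simp_all add: l2_closure_add cspan_l2_closure[OF cspan_zero])

lemma l2_closure_cong:
  assumes "g \<in> l2_closure M B" "\<And>x. x \<in> space M \<Longrightarrow> g x = h x"
  shows "h \<in> l2_closure M B"
proof -
  have "(LINT x|M. (cmod (h x - v x))\<^sup>2) = (LINT x|M. (cmod (g x - v x))\<^sup>2)" for v
    using assms(2) by (intro Bochner_Integration.integral_cong) auto
  moreover have "h \<in> L2 M"
  proof -
    have "g \<in> borel_measurable M \<longleftrightarrow> h \<in> borel_measurable M"
      using assms(2) by (intro measurable_cong) auto
    moreover have "integrable M (\<lambda>x. (cmod (g x))\<^sup>2) \<longleftrightarrow> integrable M (\<lambda>x. (cmod (h x))\<^sup>2)"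
      using assms(2) by (intro Bochner_Integration.integrable_cong) auto
    ultimately show ?thesis using assms(1) by (simp add: l2_closure_def L2_def)
  qed
  ultimately show ?thesis using assms(1) by (simp add: l2_closure_def)
qed

lemma l2_closure_limit:
  assumes "g \<in> L2 M" "\<And>e. e > 0 \<Longrightarrow> \<exists>h\<in>l2_closure M B. (LINT x|M. (cmod (g x - h x))\<^sup>2) < e"
  shows "g \<in> l2_closure M B"
proof -
  have "\<exists>v\<in>cspan B. (LINT x|M. (cmod (g x - v x))\<^sup>2) < e" if "e > 0" for e
  proof -
    have e: "e / 4 > 0" using that by simp
    obtain h where h: "h \<in> l2_closure M B" "(LINT x|M. (cmod (g x - h x))\<^sup>2) < e / 4"
      using assms(2) e by blast
    then have hL: "h \<in> L2 M" by (simp add: l2_closure_def)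
    obtain v where v: "v \<in> cspan B" "(LINT x|M. (cmod (h x - v x))\<^sup>2) < e / 4"
      using h e unfolding l2_closure_def by blast
    have "(LINT x|M. (cmod ((g x - h x) + (h x - v x)))\<^sup>2) \<le>
        2 * (LINT x|M. (cmod (g x - h x))\<^sup>2) + 2 * (LINT x|M. (cmod (h x - v x))\<^sup>2)"
      by (intro L2_sq_add_le L2_diff assms hL cspan_L2 v)
    also have "\<dots> < e" using v h by simp
    finally show ?thesis using v(1) by auto
  qed
  then show ?thesis using assms(1) by (simp add: l2_closure_def)
qed

lemma l2_closure_tendsto:
  assumes "g \<in> L2 M" "\<And>n. h n \<in> l2_closure M B"
    and w: "integrable M w" "\<And>n x. x \<in> space M \<Longrightarrow> (cmod (g x - h n x))\<^sup>2 \<le> w x"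
    and lim: "\<And>x. x \<in> space M \<Longrightarrow> (\<lambda>n. h n x) \<longlonglongrightarrow> g x"
  shows "g \<in> l2_closure M B"
proof (rule l2_closure_limit[OF assms(1)])
  fix e :: real assume e: "e > 0"
  have [measurable]: "g \<in> borel_measurable M" "\<And>n. h n \<in> borel_measurable M"
    using assms by (auto simp: l2_closure_def L2_def)
  have "(\<lambda>n. LINT x|M. (cmod (g x - h n x))\<^sup>2) \<longlonglongrightarrow> (LINT x|M. 0)"
  proof (rule integral_dominated_convergence[where w = w])
    show "AE x in M. (\<lambda>n. (cmod (g x - h n x))\<^sup>2) \<longlonglongrightarrow> 0"
      using lim by (intro AE_I2) (auto intro!: tendsto_eq_intros)
    show "AE x in M. norm ((cmod (g x - h n x))\<^sup>2) \<le> w x" for n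
      using w by (intro AE_I2) auto
  qed (use w in auto)
  then have "eventually (\<lambda>n. (LINT x|M. (cmod (g x - h n x))\<^sup>2) < e) sequentially"
    using e by (intro order_tendstoD) auto
  then show "\<exists>h\<in>l2_closure M B. (LINT x|M. (cmod (g x - h x))\<^sup>2) < e"
    using assms(2) by (meson eventually_happens' sequentially_bot)
qed

text \<open>Simple functions are combinations of indicators, and \<open>g\<close> is a pointwise
  limit of simple functions of modulus at most twice that of \<open>g\<close>; dominated convergence
  then applies.\<close>

lemma l2_closure_UNIV:
  assumes ind: "\<And>A. A \<in> sets M \<Longrightarrow> indicator A \<in> l2_closure M B" and g: "g \<in> L2 M"
  shows "g \<in> l2_closure M B"
proof -
  have simple: "s \<in> l2_closure M B" if s: "simple_function M s" for s :: "'a \<Rightarrow> complex"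
  proof -
    have "(\<lambda>x. \<Sum>y\<in>s ` space M. y * indicator (s -` {y} \<inter> space M) x) \<in> l2_closure M B"
      using s by (intro l2_closure_sum l2_closure_scale ind) (auto simp: simple_function_def)
    moreover have "(\<Sum>y\<in>s ` space M. y * indicator (s -` {y} \<inter> space M) x) = s x" if "x \<in> space M" for x
    proof -
      have "(\<Sum>y\<in>s ` space M. y * indicator (s -` {y} \<inter> space M) x) = (\<Sum>y\<in>s ` space M. if y = s x then y else 0)"
        using that by (intro sum.cong) (auto simp: indicator_def)
      also have "\<dots> = s x" using s that by (simp add: simple_function_def)
      finally show ?thesis .
    qed
    ultimately show ?thesis by (rule l2_closure_cong)
  qed
  obtain s where s: "\<And>i. simple_function M (s i)" "\<And>x. x \<in> space M \<Longrightarrow> (\<lambda>i. s i x) \<longlonglongrightarrow> g x"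
    "\<And>i x. x \<in> space M \<Longrightarrow> dist (s i x) 0 \<le> 2 * dist (g x) 0"
    using borel_measurable_implies_sequence_metric[OF L2_measurable[OF g], of 0] by metis
  show ?thesis
  \<comment> \<open>The constant is \<open>9 = (1 + 2)\<^sup>2\<close>, from the triangle inequality
    and the bound on \<open>s\<close>.\<close>
  proof (rule l2_closure_tendsto[where h = s and w = "\<lambda>x. 9 * (cmod (g x))\<^sup>2"])
    fix n x assume x: "x \<in> space M"
    have "cmod (g x - s n x) \<le> cmod (g x) + cmod (s n x)" by (rule norm_triangle_ineq4)
    then have "cmod (g x - s n x) \<le> 3 * cmod (g x)" using s(3)[OF x, of n] by simp
    then have "(cmod (g x - s n x))\<^sup>2 \<le> (3 * cmod (g x))\<^sup>2" by (rule power_mono) simp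
    then show "(cmod (g x - s n x))\<^sup>2 \<le> 9 * (cmod (g x))\<^sup>2" by (simp add: power_mult_distrib)
  qed (use s simple g in \<open>auto simp: L2_integrable\<close>)
qed

end

text \<open>Dynkin's pi-lambda argument: half-lines are stable under intersection, and the sets with
  indicator in the closure admit complements (by \<open>one\<close>) and countable disjoint unions
  (by dominated convergence). Measurability of \<open>id\<close> lets \<open>M\<close> live on a
  subset of the line.\<close>

lemma indicator_borel_l2_closure:
  fixes M :: "real measure"
  assumes fin: "finite_measure M" and B: "B \<subseteq> L2 M" and id: "id \<in> borel_measurable M"
    and le: "\<And>t. indicator {..t} \<in> l2_closure M B" and one: "(\<lambda>x. 1) \<in> l2_closure M B"
    and A: "A \<in> sets borel"
  shows "indicator A \<in> l2_closure M B"
proof -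
  interpret finite_measure M by (rule fin)
  have meas [measurable]: "(indicator A :: _ \<Rightarrow> complex) \<in> borel_measurable M" if "A \<in> sets borel" for A
    using measurable_comp[OF id borel_measurable_indicator[OF that]] by simp
  have indL2: "(indicator A :: _ \<Rightarrow> complex) \<in> L2 M" if "A \<in> sets borel" for A
    using meas[OF that] by (rule L2_bounded[where b = 1]) (auto simp: indicator_def)
  have stable: "Int_stable (range (atMost :: real \<Rightarrow> _))" by (auto simp: Int_stable_def)
  have sets_eq: "sets (borel :: real measure) = sigma_sets UNIV (range atMost)"
    by (subst borel_eq_atMost) auto
  have "range (atMost :: real \<Rightarrow> _) \<subseteq> Pow UNIV" "A \<in> sigma_sets UNIV (range atMost)"
    using A sets_eq by auto
  with stable show ?thesis
  proof (induction rule: sigma_sets_induct_disjoint)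
    case (basic A)
    then show ?case using le by auto
  next
    case empty
    show ?case using cspan_l2_closure[OF B cspan_zero] by simp
  next
    case (compl A)
    have "(\<lambda>x. 1 + (-1) * indicator A x) \<in> l2_closure M B"
      by (intro l2_closure_add[OF B] l2_closure_scale[OF B] one compl)
    moreover have "(\<lambda>x. 1 + (-1) * indicator A x :: complex) = indicator (UNIV - A)"
      by (auto simp: indicator_def fun_eq_iff)
    ultimately show ?case by simp
  next
    case (union A)
    have sA: "A i \<in> sets borel" for i using union(2) sets_eq by auto
    define h where "h n x = (\<Sum>i<n. indicator (A i) x :: complex)" for n x
    have h_eq: "h n x = indicator (\<Union>i<n. A i) x" for n x
      unfolding h_def using union(1)
      by (subst indicator_UN_disjoint) (auto simp: disjoint_family_on_def)
    show ?case
    proof (rule l2_closure_tendsto[OF B, where h = h and w = "\<lambda>x. 1"])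
      show "h n \<in> l2_closure M B" for n
        unfolding h_def by (intro l2_closure_sum[OF B] union) auto
      show "(\<lambda>n. h n x) \<longlonglongrightarrow> indicator (\<Union> (range A)) x" for x
        unfolding h_eq by (rule LIMSEQ_indicator_UN)
      show "(indicator (\<Union> (range A)) :: _ \<Rightarrow> complex) \<in> L2 M"
        using sA by (intro indL2) auto
    qed (auto simp: h_eq indicator_def)
  qed
qed

section \<open>Dyadic characters\<close>

lemma root_unity_norm:
  assumes "(\<zeta>::complex) ^ k = 1" "k \<ge> 1"
  shows "cmod \<zeta> = 1"
  using assms power_eq_1_iff by fastforce

lemma root_unity_power_mod:
  assumes "(\<zeta>::complex) ^ k = 1"
  shows "\<zeta> ^ (n mod k) = \<zeta> ^ n"
proof -
  have "\<zeta> ^ n = \<zeta> ^ (k * (n div k) + n mod k)" by simp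
  also have "\<dots> = \<zeta> ^ (n mod k)" by (simp only: power_add power_mult assms power_one mult_1)
  finally show ?thesis by simp
qed

text \<open>Orthogonality of the characters of a cyclic group. The exponent \<open>k - i\<close>
  stands for \<open>- i\<close>; the terms are powers of one root of unity \<open>z\<close>, which
  is 1 exactly if \<open>a = i\<close>, and otherwise the geometric sum vanishes.\<close>

lemma sum_roots_unity_indicator:
  assumes "a < k" "i < k"
  shows "(\<Sum>j<k. (1 / of_nat k) * (cis (2 * pi * real j / real k)) ^ (k - i) * cis (2 * pi * real j / real k) ^ a)
      = (if a = i then 1 else 0)"
proof -
  define \<omega> where "\<omega> = cis (2 * pi / real k)"
  have \<omega>: "\<omega> ^ n = cis (2 * pi * real n / real k)" for n
    unfolding \<omega>_def Complex.DeMoivre by (simp add: mult_ac)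
  have \<omega>k: "\<omega> ^ k = 1" using assms by (simp add: \<omega> cis_multiple_2pi[of 1, simplified])
  define z where "z = \<omega> ^ (k - i + a)"
  have "(\<Sum>j<k. (1 / of_nat k) * (cis (2 * pi * real j / real k)) ^ (k - i) * cis (2 * pi * real j / real k) ^ a)
     = (\<Sum>j<k. (1 / of_nat k) * z ^ j)"
    unfolding z_def \<omega>[symmetric] 
    by (intro sum.cong refl) (simp add: power_mult[symmetric] power_add[symmetric] algebra_simps)
  also have "\<dots> = (1 / of_nat k) * (\<Sum>j<k. z ^ j)" by (rule sum_distrib_left[symmetric])
  also have "\<dots> = (if a = i then 1 else 0)"
  proof (cases "a = i")
    case True
    then have "z = 1" using assms \<omega>k by (simp add: z_def)
    then show ?thesis using True assms by simp
  next
    case False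
    have "z \<noteq> 1"
    proof
      assume "z = 1"
      then have "\<omega> ^ i = \<omega> ^ (k - i + a) * \<omega> ^ i" by (simp add: z_def)
      also have "\<dots> = \<omega> ^ (k + a)" using assms by (simp add: power_add[symmetric])
      also have "\<dots> = \<omega> ^ a" by (simp add: power_add \<omega>k)
      finally have "cis (2 * pi * real i / real k) = cis (2 * pi * real a / real k)" by (simp add: \<omega>)
      moreover have "inj_on (\<lambda>j. cis (2 * pi * real j / real k)) {..<k}"
        using Complex.bij_betw_roots_unity[of k] assms by (auto simp: bij_betw_def)
      ultimately show False using assms False by (auto dest: inj_onD)
    qed
    moreover have "z ^ k = 1" unfolding z_def by (metis \<omega>k mult.commute power_mult power_one)
    ultimately have "(\<Sum>j<k. z ^ j) = 0" by (simp add: geometric_sum)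
    then show ?thesis using False by simp
  qed
  finally show ?thesis .
qed

section \<open>Invariant measures, characters and their density\<close>

locale minimal_orbit_measure = minimal_orbit +
  fixes M :: "real measure"
  assumes prob: "prob_space M" and sets_M: "sets M = sets (restrict_space borel K)"
    and invar: "invariant_measure M f"
begin

sublocale prob_space M by (rule prob)

lemma space_M: "space M = K"
  using sets_eq_imp_space_eq[OF sets_M] by (simp add: space_restrict_space)

lemma in_piece_iff:
  assumes "separated k" "x \<in> K" "i < k"
  shows "x \<in> piece k i \<longleftrightarrow> addr k x = i"
  using addr(2)[OF assms(1,2)] addr_eqI[OF assms(1), of x i] assms(3) by auto

lemma f_K: "x \<in> K \<Longrightarrow> f x \<in> K"
  using min by (auto simp: minimal_subset_def)

lemma f_meas [measurable]: "f \<in> measurable M M"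
  using invar by (simp add: invariant_measure_def)

lemma piece_meas [measurable]: "piece k i \<in> sets M"
  unfolding sets_M sets_restrict_space using piece_subset[of k i] closed_piece[of k i]
  by (intro image_eqI[of _ _ "piece k i"]) auto

lemma distr_f: "distr M M f = M"
proof (rule measure_eqI)
  fix A assume "A \<in> sets (distr M M f)"
  then show "emeasure (distr M M f) A = emeasure M A"
    using invar by (simp add: emeasure_distr emeasure_eq_measure invariant_measure_def)
qed simp

text \<open>Each piece is the full preimage in \<open>K\<close> of the next one, so invariance makes
  all masses equal; the \<open>k\<close> disjoint pieces share the total mass 1.\<close>

lemma measure_piece:
  assumes k: "separated k"
  shows "measure M (piece k i) = 1 / k"
proof -
  have k1: "k \<ge> 1" by (rule separated_pos[OF k])
  have step: "measure M (piece k (Suc i)) = measure M (piece k i)" for i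
  proof -
    have "f -` piece k (Suc i) \<inter> K = piece k i"
    proof (intro set_eqI iffI)
      fix x assume x: "x \<in> f -` piece k (Suc i) \<inter> K"
      then have "Suc (addr k x) mod k = Suc i mod k"
        using addr_f[OF k, of x] addr_eqI[OF k, of "f x" "Suc i"] by simp
      \<comment> \<open>Adding \<open>k - 1\<close> undoes the successor modulo
        \<open>k\<close>.\<close>
      then have "(Suc (addr k x) + (k - 1)) mod k = (Suc i + (k - 1)) mod k"
        by (rule mod_add_cong) simp
      then have "addr k x mod k = i mod k" using k1 by simp
      then show "x \<in> piece k i" using addr(2)[OF k, of x] x piece_cong[of "addr k x" k i] by simp
    next
      fix x assume "x \<in> piece k i"
      then show "x \<in> f -` piece k (Suc i) \<inter> K" using f_piece subsetD[OF piece_subset] by auto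
    qed
    moreover have "measure M (f -` piece k (Suc i) \<inter> space M) = measure M (piece k (Suc i))"
      using invar piece_meas by (simp add: invariant_measure_def)
    ultimately show ?thesis by (simp add: space_M)
  qed
  have const: "measure M (piece k i) = measure M (piece k 0)" for i
    by (induction i) (simp_all add: step)
  have "K \<subseteq> (\<Union>i<k. piece k i)" by (rule subsetI, erule K_covered[OF k1]) auto
  moreover have "(\<Union>i<k. piece k i) \<subseteq> K" by (intro UN_least piece_subset)
  ultimately have "K = (\<Union>i<k. piece k i)" by (rule equalityI)
  then have "1 = measure M (\<Union>i<k. piece k i)" using prob_space space_M by simp
  also have "\<dots> = (\<Sum>i<k. measure M (piece k i))"
  proof (rule finite_measure_finite_Union)
    show "disjoint_family_on (piece k) {..<k}"
      unfolding disjoint_family_on_def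
    proof (intro ballI impI)
      fix i j assume "i \<in> {..<k}" "j \<in> {..<k}" "i \<noteq> j"
      then show "piece k i \<inter> piece k j = {}" using separated_unique[OF k, of _ i j] by auto
    qed
  qed auto
  also have "\<dots> = (\<Sum>i<k. measure M (piece k 0))" by (intro sum.cong refl const)
  finally show ?thesis using const[of i] k1 by (simp add: field_simps)
qed

text \<open>Extension by \<open>0\<close> outside \<open>K\<close> makes characters with the same eigenvalue equal as
  functions, as orthonormality demands.\<close>

definition character :: "nat \<Rightarrow> complex \<Rightarrow> real \<Rightarrow> complex" where
  "character k \<zeta> x = (if x \<in> K then \<zeta> ^ addr k x else 0)"

definition characters :: "(real \<Rightarrow> complex) set" where
  "characters = {character (2 ^ n) \<zeta> | n \<zeta>. separated (2 ^ n) \<and> \<zeta> ^ (2 ^ n) = 1}"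

lemma character_f:
  assumes "separated k" "\<zeta> ^ k = 1" "x \<in> K"
  shows "character k \<zeta> (f x) = \<zeta> * character k \<zeta> x"
  using assms f_K by (simp add: character_def addr_f root_unity_power_mod)

lemma character_norm:
  assumes "separated k" "\<zeta> ^ k = 1" "x \<in> K"
  shows "cmod (character k \<zeta> x) = 1"
  using assms root_unity_norm[OF assms(2) separated_pos[OF assms(1)]] by (simp add: character_def norm_power)

text \<open>Powers of \<zeta> depend on the exponent modulo \<open>k\<close> only, so refining the
  address changes nothing: a character is determined by its eigenvalue alone.\<close>

lemma character_refine:
  assumes "separated k" "separated l" "k dvd l" "\<zeta> ^ k = 1"
  shows "character k \<zeta> = character l \<zeta>"
  using assms by (auto simp: character_def fun_eq_iff root_unity_power_mod addr_refine[OF assms(1-3)])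

lemma character_L2:
  assumes k: "separated k" and \<zeta>: "\<zeta> ^ k = 1"
  shows "character k \<zeta> \<in> L2 M"
proof (rule L2_bounded[where b = 1])
  have "(\<lambda>x. \<Sum>i<k. \<zeta> ^ i * indicator (piece k i) x) \<in> borel_measurable M" by measurable
  moreover have "(\<Sum>i<k. \<zeta> ^ i * indicator (piece k i) x) = character k \<zeta> x" if "x \<in> space M" for x
  proof -
    have x: "x \<in> K" using that space_M by simp
    have "(\<Sum>i<k. \<zeta> ^ i * indicator (piece k i) x) = (\<Sum>i<k. if i = addr k x then \<zeta> ^ i else 0)"
      using in_piece_iff[OF k x] by (intro sum.cong) (auto simp: indicator_def)
    then show ?thesis using addr[OF k x] x by (simp add: character_def)
  qed
  ultimately show "character k \<zeta> \<in> borel_measurable M"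
    using measurable_cong[of M "\<lambda>x. \<Sum>i<k. \<zeta> ^ i * indicator (piece k i) x" "character k \<zeta>"] by blast
qed (use character_norm[OF k \<zeta>] space_M in simp)

lemma characters_L2: "characters \<subseteq> L2 M"
  using character_L2 by (auto simp: characters_def)

text \<open>Equal eigenvalues give the same function, of modulus 1 on \<open>K\<close>. For
  different ones, invariance multiplies the inner product by \<open>\<zeta> * cnj \<mu>\<close>,
  which is not 1, so the product vanishes.\<close>

lemma characters_orthonormal:
  assumes "g \<in> characters" "h \<in> characters"
  shows "L2_inner M g h = (if g = h then 1 else 0)"
proof -
  obtain n \<zeta> where g: "separated (2 ^ n)" "\<zeta> ^ (2 ^ n) = 1" "g = character (2 ^ n) \<zeta>"
    using assms by (auto simp: characters_def)
  obtain m \<mu> where h: "separated (2 ^ m)" "\<mu> ^ (2 ^ m) = 1" "h = character (2 ^ m) \<mu>"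
    using assms by (auto simp: characters_def)
  have [measurable]: "g \<in> borel_measurable M" "h \<in> borel_measurable M"
    using assms characters_L2 L2_measurable by blast+
  have [measurable]: "(\<lambda>x. cnj (h x)) \<in> borel_measurable M"
    by (rule measurable_compose[OF \<open>h \<in> borel_measurable M\<close>])
      (intro borel_measurable_continuous_onI continuous_intros)
  show ?thesis
  proof (cases "\<zeta> = \<mu>")
    case True
    have "g = h"
    proof (cases "n \<le> m")
      case le: True
      then show ?thesis using character_refine[OF g(1) h(1) le_imp_power_dvd[OF le] g(2)] g(3) h(3) True by simp
    next
      case False
      then have "m \<le> n" by simp
      then show ?thesis using character_refine[OF h(1) g(1) le_imp_power_dvd h(2)] g(3) h(3) True by simp
    qed
    have "L2_inner M g h = (LINT x|M. 1)"
      unfolding L2_inner_def \<open>g = h\<close>[symmetric]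
      using character_norm[OF g(1,2)] g(3) space_M
      by (intro Bochner_Integration.integral_cong) (auto simp: complex_norm_square[symmetric])
    then show ?thesis using \<open>g = h\<close> by (simp add: prob_space)
  next
    case False
    have "L2_inner M g h = (LINT x|distr M M f. g x * cnj (h x))"
      by (simp add: L2_inner_def distr_f)
    also have "\<dots> = (LINT x|M. g (f x) * cnj (h (f x)))"
      by (rule integral_distr) measurable
    also have "\<dots> = (LINT x|M. (\<zeta> * cnj \<mu>) * (g x * cnj (h x)))"
      using character_f[OF g(1,2)] character_f[OF h(1,2)] g(3) h(3) space_M
      by (intro Bochner_Integration.integral_cong) auto
    also have "\<dots> = \<zeta> * cnj \<mu> * L2_inner M g h"
      unfolding L2_inner_def by (rule integral_mult_right_zero)
    finally have eq: "L2_inner M g h = \<zeta> * cnj \<mu> * L2_inner M g h" .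
    have "cmod \<mu> = 1" using root_unity_norm[OF h(2)] by simp
    then have "cnj \<mu> * \<mu> = 1" using complex_norm_square[of \<mu>] by (simp add: mult.commute)
    then have "\<zeta> * cnj \<mu> \<noteq> 1" using False by (metis mult.assoc mult.left_neutral mult.right_neutral)
    then have zero: "L2_inner M g h = 0" using eq by (metis mult_cancel_right1)
    \<comment> \<open>The value 0 must also match the condition \<open>g = h\<close>: characters do
      not vanish at \<open>x0\<close>, so different eigenvalues mean different functions.\<close>
    have "g \<noteq> h"
    proof
      assume "g = h"
      then have "\<zeta> * g x0 = \<mu> * g x0"
        using character_f[OF g(1,2) x0] character_f[OF h(1,2) x0] unfolding g(3)[symmetric] h(3)[symmetric] by metis
      moreover have "g x0 \<noteq> 0" using character_norm[OF g(1,2) x0] g(3) by auto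
      ultimately show False using False by simp
    qed
    then show ?thesis using zero by simp
  qed
qed

lemma character_eigenfunction:
  assumes "g \<in> characters"
  shows "\<exists>c. L2_eigenfunction M f c g"
proof -
  obtain n \<zeta> where g: "separated (2 ^ n)" "\<zeta> ^ (2 ^ n) = 1" "g = character (2 ^ n) \<zeta>"
    using assms by (auto simp: characters_def)
  have "\<not> (AE x in M. g x = 0)"
  proof
    assume "AE x in M. g x = 0"
    then have "AE x in M. False"
      by (rule AE_mp) (use character_norm[OF g(1,2)] g(3) space_M in \<open>fastforce intro!: AE_I2\<close>)
    then show False by simp
  qed
  moreover have "AE x in M. g (f x) = \<zeta> * g x"
    using character_f[OF g(1,2)] g(3) space_M by (intro AE_I2) auto
  ultimately show ?thesis
    using assms characters_L2 by (auto simp: L2_eigenfunction_def)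
qed

text \<open>Fourier inversion on the cyclic group of order \<open>2 ^ n\<close>, composed with the
  address map.\<close>

lemma indicator_piece_cspan:
  assumes k: "separated (2 ^ n)"
  shows "indicator (piece (2 ^ n) i) \<in> cspan characters"
proof -
  define N :: nat where "N = 2 ^ n"
  have kN: "separated N" using k by (simp add: N_def)
  have N: "N > 0" by (simp add: N_def)
  \<comment> \<open>The index is reduced so that \<open>N - j\<close> is a genuine
    difference.\<close>
  define j where "j = i mod N"
  have j: "j < N" "piece N i = piece N j" using N piece_cong[of i N j] by (auto simp: j_def)
  define \<omega> where "\<omega> m = cis (2 * pi * real m / real N)" for m
  have \<omega>: "\<omega> m ^ N = 1" if "m < N" for m
    using Complex.bij_betw_roots_unity[OF N] that by (auto simp: bij_betw_def \<omega>_def)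
  have "(\<lambda>x. \<Sum>m<N. (1 / of_nat N * \<omega> m ^ (N - j)) * character N (\<omega> m) x) \<in> cspan characters"
    using \<omega> k by (intro cspan_sum cspan_scale cspan_base) (auto simp: characters_def N_def)
  moreover have "(\<Sum>m<N. (1 / of_nat N * \<omega> m ^ (N - j)) * character N (\<omega> m) x) = indicator (piece N j) x" for x
  proof (cases "x \<in> K")
    case True
    show ?thesis
      using True in_piece_iff[OF kN True j(1)] sum_roots_unity_indicator[OF addr(1)[OF kN True] j(1)]
      by (simp add: character_def \<omega>_def indicator_def)
  next
    case False
    then have "x \<notin> piece N j" using piece_subset by blast
    then show ?thesis using False by (simp add: character_def)
  qed
  ultimately have "(\<lambda>x. indicator (piece N j) x) \<in> cspan characters" by simp
  then show ?thesis using j by (simp add: N_def)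
qed

text \<open>Only the piece straddling \<open>t\<close> prevents the initial segment up to \<open>t\<close> from being a union
  of pieces; its measure tends to \<open>0\<close> with the level unless the pieces become single points.\<close>

lemma indicator_atMost_l2_closure:
  assumes tower: "(\<forall>n. separated (2 ^ n)) \<or> (\<exists>n. separated (2 ^ n) \<and> (\<forall>i. \<exists>c. piece (2 ^ n) i \<subseteq> {c}))"
  shows "indicator {..t} \<in> l2_closure M characters"
proof -
  have atMost [measurable]: "{..t} \<inter> K \<in> sets M"
    unfolding sets_M sets_restrict_space by (intro image_eqI[of _ _ "{..t}"]) auto
  have meas: "(indicator {..t} :: _ \<Rightarrow> complex) \<in> borel_measurable M"
  proof -
    have "(indicator ({..t} \<inter> K) :: _ \<Rightarrow> complex) \<in> borel_measurable M" by measurable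
    moreover have "(indicator ({..t} \<inter> K) :: _ \<Rightarrow> complex) \<in> borel_measurable M \<longleftrightarrow>
        (indicator {..t} :: _ \<Rightarrow> complex) \<in> borel_measurable M"
      by (rule measurable_cong) (simp add: space_M indicator_def)
    ultimately show ?thesis by simp
  qed
  have "indicator {..t} \<in> L2 M" using meas by (rule L2_bounded[where b = 1]) (auto simp: indicator_def)
  moreover have "\<exists>v\<in>cspan characters. (LINT x|M. (cmod (indicator {..t} x - v x))\<^sup>2) < e" if e: "e > 0" for e
  proof -
    define D where "D k = {x\<in>K. x \<le> t \<and> \<not> piece k (addr k x) \<subseteq> {..t}}" for k
    have D_piece: "\<exists>j. D k \<subseteq> piece k j" if k: "separated k" for k
    \<comment> \<open>Two different pieces that both meet \<open>{..t}\<close> and reach beyond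
      \<open>t\<close> cannot lie one entirely below the other, so at most one piece straddles
      \<open>t\<close>.\<close>
    proof -
      have "addr k x = addr k y" if xy: "x \<in> D k" "y \<in> D k" for x y
      proof (rule ccontr)
        assume "addr k x \<noteq> addr k y"
        moreover have K: "x \<in> K" "y \<in> K" "x \<le> t" "y \<le> t" using xy by (auto simp: D_def)
        ultimately have "addr k x mod k \<noteq> addr k y mod k" using addr(1)[OF k] by simp
        moreover obtain z w where "z \<in> piece k (addr k x)" "w \<in> piece k (addr k y)" "z > t" "w > t"
          using xy by (fastforce simp: D_def)
        ultimately show False
          using K addr(2)[OF k K(1)] addr(2)[OF k K(2)] k unfolding separated_def by fastforce
      qed
      then have "D k \<subseteq> piece k (addr k x)" if "x \<in> D k" for x
        using that addr(2)[OF k] by (fastforce simp: D_def)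
      then show ?thesis by (cases "D k = {}") auto
    qed
    \<comment> \<open>Rewritten as a finite union of pieces cut at \<open>t\<close> to obtain
      measurability.\<close>
    have D_eq: "D k = ({..t} \<inter> K) \<inter> (\<Union>i\<in>{i. i < k \<and> \<not> piece k i \<subseteq> {..t}}. piece k i)" if k: "separated k" for k
    proof (intro set_eqI iffI)
      fix x assume "x \<in> D k"
      then show "x \<in> ({..t} \<inter> K) \<inter> (\<Union>i\<in>{i. i < k \<and> \<not> piece k i \<subseteq> {..t}}. piece k i)"
        using addr[OF k, of x] by (auto simp: D_def)
    next
      fix x assume "x \<in> ({..t} \<inter> K) \<inter> (\<Union>i\<in>{i. i < k \<and> \<not> piece k i \<subseteq> {..t}}. piece k i)"
      then obtain i where i: "x \<in> K" "x \<le> t" "i < k" "\<not> piece k i \<subseteq> {..t}" "x \<in> piece k i" by auto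
      then have "addr k x = i" using addr_eqI[OF k i(5)] by simp
      then show "x \<in> D k" using i by (simp add: D_def)
    qed
    have D_meas: "D k \<in> sets M" if "separated k" for k
      unfolding D_eq[OF that] by (rule sets.Int[OF atMost], rule sets.finite_UN) auto
    have "\<exists>n. separated (2 ^ n) \<and> measure M (D (2 ^ n)) < e"
      using tower
    proof
      assume sep: "\<forall>n. separated (2 ^ n)"
      obtain n where n: "(1 / 2) ^ n < e" using real_arch_pow_inv[OF e, of "1/2"] by auto
      obtain j where "D (2 ^ n) \<subseteq> piece (2 ^ n) j" using D_piece sep by blast
      then have "measure M (D (2 ^ n)) \<le> measure M (piece (2 ^ n) j)"
        by (intro finite_measure_mono) auto
      also have "\<dots> = (1 / 2) ^ n" using measure_piece[of "2 ^ n" j] sep by (simp add: power_divide)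
      finally show ?thesis using n sep by (intro exI[of _ n]) auto
    next
      assume "\<exists>n. separated (2 ^ n) \<and> (\<forall>i. \<exists>c. piece (2 ^ n) i \<subseteq> {c})"
      then obtain n where n: "separated (2 ^ n)" "\<And>i. \<exists>c. piece (2 ^ n) i \<subseteq> {c}" by blast
      have "x \<notin> D (2 ^ n)" for x
      proof
        assume "x \<in> D (2 ^ n)"
        then have "x \<in> piece (2 ^ n) (addr (2 ^ n) x)" "x \<le> t" "\<not> piece (2 ^ n) (addr (2 ^ n) x) \<subseteq> {..t}"
          using addr(2)[OF n(1)] by (auto simp: D_def)
        then show False using n(2)[of "addr (2 ^ n) x"] by auto
      qed
      then have "D (2 ^ n) = {}" by blast
      then show ?thesis using n(1) e by (intro exI[of _ n]) simp
    qed
    then obtain n where n: "separated (2 ^ n)" "measure M (D (2 ^ n)) < e" by blast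
    define k :: nat where "k = 2 ^ n"
    have k: "separated k" "measure M (D k) < e" using n by (simp_all add: k_def)
    define S where "S = {i. i < k \<and> piece k i \<subseteq> {..t}}"
    have fin: "finite S" by (simp add: S_def)
    \<comment> \<open>On \<open>K\<close>, \<open>v\<close> is the indicator of the union of the
      pieces inside \<open>{..t}\<close>; it differs from that of \<open>{..t}\<close> exactly on
      \<open>D k\<close>.\<close>
    define v where "v = (\<lambda>x. \<Sum>i\<in>S. indicator (piece k i) x :: complex)"
    have "v \<in> cspan characters"
      unfolding v_def k_def using fin indicator_piece_cspan[OF n(1)] by (intro cspan_sum)
    moreover have "(LINT x|M. (cmod (indicator {..t} x - v x))\<^sup>2) < e"
    proof -
      have "(cmod (indicator {..t} x - v x))\<^sup>2 = indicator (D k) x" if "x \<in> space M" for x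
      proof -
        have x: "x \<in> K" using that space_M by simp
        have "v x = (\<Sum>i\<in>S. if i = addr k x then 1 else 0)"
          unfolding v_def using in_piece_iff[OF k(1) x]
          by (intro sum.cong) (auto simp: indicator_def S_def)
        also have "\<dots> = (if addr k x \<in> S then 1 else 0)" using fin by simp
        finally show ?thesis using x addr[OF k(1) x] by (auto simp: indicator_def D_def S_def)
      qed
      then have "(LINT x|M. (cmod (indicator {..t} x - v x))\<^sup>2) = (LINT x|M. indicator (D k) x)"
        by (intro Bochner_Integration.integral_cong) auto
      also have "\<dots> = measure M (D k)" using D_meas[OF k(1)] by simp
      finally show ?thesis using k(2) by simp
    qed
    ultimately show ?thesis by blast
  qed
  ultimately show ?thesis by (simp add: l2_closure_def)
qed

text \<open>Density climbs from half-lines to Borel sets, to their traces on \<open>K\<close>, and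
  from there to all of \<open>L2 M\<close>.\<close>

lemma discrete_spectrum_tower:
  assumes tower: "(\<forall>n. separated (2 ^ n)) \<or> (\<exists>n. separated (2 ^ n) \<and> (\<forall>i. \<exists>c. piece (2 ^ n) i \<subseteq> {c}))"
  shows "discrete_spectrum M f"
proof -
  note B = characters_L2
  \<comment> \<open>At level \<open>2 ^ 0\<close> the only piece is \<open>K\<close>, whose
    indicator agrees with 1 on the space of \<open>M\<close>.\<close>
  have one: "(\<lambda>x. 1) \<in> l2_closure M characters"
  proof -
    have "x \<in> piece 1 0" if "x \<in> K" for x using K_covered[OF order_refl that] by auto
    then have "piece 1 0 = K" using piece_subset[of 1 0] by blast
    then have "indicator K \<in> l2_closure M characters"
      using indicator_piece_cspan[of 0 0] separated_1 cspan_l2_closure[OF B] by simp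
    then show ?thesis by (rule l2_closure_cong[OF B]) (simp add: space_M)
  qed
  have id: "id \<in> borel_measurable M"
    unfolding measurable_cong_sets[OF sets_M refl] by (rule measurable_restrict_space1) (simp add: id_def)
  have closure: "g \<in> l2_closure M characters" if g: "g \<in> L2 M" for g
  proof (rule l2_closure_UNIV[OF B _ g])
    fix A assume "A \<in> sets M"
    then obtain A' where A': "A' \<in> sets borel" "A = K \<inter> A'"
      unfolding sets_M sets_restrict_space by auto
    have "indicator A' \<in> l2_closure M characters"
      using indicator_borel_l2_closure[OF finite_measure_axioms B id indicator_atMost_l2_closure[OF tower] one A'(1)] .
    then show "indicator A \<in> l2_closure M characters"
      by (rule l2_closure_cong[OF B]) (simp add: A'(2) space_M indicator_def)
  qed
  have dense: "\<exists>F c. finite F \<and> F \<subseteq> characters \<and> L2_norm M (\<lambda>x. g x - (\<Sum>h\<in>F. c h * h x)) < e"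
    if g: "g \<in> L2 M" and e: "e > 0" for g e
  proof -
    \<comment> \<open>The closure is measured by the squared norm, the basis property by the norm
      itself.\<close>
    have "e\<^sup>2 > 0" using e by simp
    then obtain v where v: "v \<in> cspan characters" "(LINT x|M. (cmod (g x - v x))\<^sup>2) < e\<^sup>2"
      using closure[OF g] unfolding l2_closure_def by blast
    have "L2_norm M (\<lambda>x. g x - v x) < e"
      unfolding L2_norm_def using v(2) e by (intro real_less_lsqrt) auto
    then show ?thesis using cspan_finite_sum[OF v(1)] by blast
  qed
  have "L2_orthonormal_basis M characters"
    unfolding L2_orthonormal_basis_def by (intro conjI ballI allI impI B characters_orthonormal dense)
  then show ?thesis
    unfolding discrete_spectrum_def using character_eigenfunction by blast
qed

end

theorem corollary3:
  fixes a b :: real and f :: "real \<Rightarrow> real" and K :: "real set" and M :: "real measure"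
  assumes "a \<le> b"
    and "continuous_on {a..b} f"
    and "f ` {a..b} \<subseteq> {a..b}"
    and "topological_entropy {a..b} f = 0"
    and "minimal_subset {a..b} f K"
    and "regular_borel_prob K M"
    and "ergodic_measure M f"
  shows "discrete_spectrum M f"
proof -
  have M: "prob_space M" "sets M = sets (restrict_space borel K)" "invariant_measure M f"
    using assms(6,7) by (auto simp: regular_borel_prob_def ergodic_measure_def)
  interpret prob_space M by (rule M(1))
  have "space M = K" using sets_eq_imp_space_eq[OF M(2)] by (simp add: space_restrict_space)
  \<comment> \<open>\<open>minimal_subset\<close> admits the empty set; the base point comes from
    the probability measure on \<open>K\<close>.\<close>
  then obtain x0 where x0: "x0 \<in> K" using not_empty by blast
  interpret minimal_orbit_measure "{a..b}" f K x0 M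
    by unfold_locales (use assms x0 M in auto)
  have "\<not> horseshoe f {a..b} n" for n
    using horseshoe_entropy_pos[of f "{a..b}" n] assms(4) by auto
  then show ?thesis
    by (intro discrete_spectrum_tower separated_tower) (auto simp: convex_real_interval)
qed

end
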